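(* Let \(G\) be a 2-connected graph and let \(C_1,\dots,C_\ell\) be its triconnected components. For \(i\in[\ell]\) let \(\overline{C}_i\) be the trigraph obtained from \(C_i\) by colouring red every virtual edge (every pair of distinct vertices of an adhesion set contained in the bag of \(C_i\)), all other edges staying black. Then \[\operatorname{tww}(G)\leq \max\left(8\max_{i\in [\ell]}\operatorname{tww}(\overline{C}_i)+6,\ 18\right).\]
   Context: A tree decomposition of \(G\) is a pair \((T,\{B_t\}_{t\in V(T)})\) with \(T\) a tree and bags \(B_t\subseteq V(G)\) such that every vertex is in some bag, the bags containing any fixed vertex form a subtree, and every edge lies within some bag. Its adhesion sets are the sets \(B_s\cap B_t\) for edges \(st\) of \(T\). The torso of a bag \(B_t\) is the graph \(G[B_t]\) with every adhesion set \(B_t\cap B_s\) (\(st\in E(T)\)) completed to a clique; pairs of vertices in such adhesion sets are called virtual edges. Every 2-connected graph has a canonical (isomorphism-invariant) tree decomposition of adhesion at most 2 in which every torso is 3-connected, a cycle, or a complete graph on 2 vertices; the triconnected components of \(G\) are the torsos of this decomposition. A trigraph is a graph whose edges are partitioned into black and red edges. For distinct vertices \(x,y\), the contraction \(G/xy\) replaces \(x,y\) by a new vertex \(z\), keeps edges not incident to \(x,y\), joins \(z\) by a black edge to every common black neighbour of \(x,y\), and by a red edge to every other vertex adjacent to \(x\) or \(y\). The twin-width \(\operatorname{tww}\) is the minimum, over all sequences of contractions reducing the trigraph to a single vertex, of the maximum red degree occurring. *)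

theory Defs
  imports "Graph_Theory.Graph_Theory"
begin

section \<open>Graphs\<close>

text \<open>
  A finite simple graph is a \<^locale>\<open>pair_graph\<close>: a finite, loop-free, symmetric arc relation.
  Every undirected edge occurs as a pair of opposite arcs.
\<close>

definition k_connected :: "nat \<Rightarrow> 'a pair_pre_digraph \<Rightarrow> bool" where
  "k_connected k G \<longleftrightarrow> k < card (pverts G) \<and>
     (\<forall>S \<subseteq> pverts G. card S < k \<longrightarrow> connected (with_proj G \<restriction> (pverts G - S)))"

definition cycle_graph :: "'a pair_pre_digraph \<Rightarrow> bool" where
  "cycle_graph G \<longleftrightarrow> (\<exists>vs. 3 \<le> length vs \<and> distinct vs \<and> pverts G = set vs \<and>
     parcs G = {(vs ! i, vs ! j) | i j. i < length vs \<and> j < length vs \<and>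
                  (j = Suc i mod length vs \<or> i = Suc j mod length vs)})"

text \<open>
  The library's \<^const>\<open>tree\<close> is unsuitable for symmetric digraphs, because an edge \<open>uv\<close> already
  yields the directed cycle \<open>u, v, u\<close>. An undirected cycle is a directed one of length at least 3.
\<close>

definition undirected_tree :: "'t pair_pre_digraph \<Rightarrow> bool" where
  "undirected_tree T \<longleftrightarrow> pair_graph T \<and> connected (with_proj T) \<and>
     \<not> (\<exists>p. pre_digraph.cycle (with_proj T) p \<and> 3 \<le> length p)"

definition automorphism :: "'a pair_pre_digraph \<Rightarrow> ('a, 'a \<times> 'a, 'a, 'a \<times> 'a) digraph_isomorphism \<Rightarrow> bool" where
  "automorphism G f \<longleftrightarrow>
     pre_digraph.digraph_isomorphism (with_proj G) f \<and> app_iso f (with_proj G) = with_proj G"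

section \<open>Tree decompositions\<close>

definition tree_decomposition :: "'a pair_pre_digraph \<Rightarrow> 't pair_pre_digraph \<Rightarrow> ('t \<Rightarrow> 'a set) \<Rightarrow> bool" where
  "tree_decomposition G T B \<longleftrightarrow>
     undirected_tree T \<and>
     (\<forall>t \<in> pverts T. B t \<subseteq> pverts G) \<and>
     (\<forall>v \<in> pverts G. \<exists>t \<in> pverts T. v \<in> B t) \<and>
     (\<forall>v \<in> pverts G. connected (with_proj T \<restriction> {t \<in> pverts T. v \<in> B t})) \<and>
     (\<forall>(u, v) \<in> parcs G. \<exists>t \<in> pverts T. u \<in> B t \<and> v \<in> B t)"

definition adhesion_at_most :: "nat \<Rightarrow> 't pair_pre_digraph \<Rightarrow> ('t \<Rightarrow> 'a set) \<Rightarrow> bool" where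
  "adhesion_at_most k T B \<longleftrightarrow> (\<forall>(s, t) \<in> parcs T. card (B s \<inter> B t) \<le> k)"

definition virtual_edges :: "'t pair_pre_digraph \<Rightarrow> ('t \<Rightarrow> 'a set) \<Rightarrow> 't \<Rightarrow> 'a rel" where
  "virtual_edges T B t = {(u, v). u \<noteq> v \<and> (\<exists>s. (s, t) \<in> parcs T \<and> {u, v} \<subseteq> B s \<inter> B t)}"

definition torso :: "'a pair_pre_digraph \<Rightarrow> 't pair_pre_digraph \<Rightarrow> ('t \<Rightarrow> 'a set) \<Rightarrow> 't \<Rightarrow> 'a pair_pre_digraph" where
  "torso G T B t = \<lparr> pverts = B t, parcs = (parcs G \<inter> B t \<times> B t) \<union> virtual_edges T B t \<rparr>"

text \<open>
  Isomorphism invariance of a single decomposition: every automorphism of the graph is induced on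
  the bags by an automorphism of the tree. Every isomorphism-invariant assignment of tree
  decompositions to graphs takes such values, so the notion does not depend on the choice of one
  particular assignment.
\<close>

definition canonical_decomposition :: "'a pair_pre_digraph \<Rightarrow> 't pair_pre_digraph \<Rightarrow> ('t \<Rightarrow> 'a set) \<Rightarrow> bool" where
  "canonical_decomposition G T B \<longleftrightarrow>
     (\<forall>f. automorphism G f \<longrightarrow>
       (\<exists>g. automorphism T g \<and> (\<forall>t \<in> pverts T. B (iso_verts g t) = iso_verts f ` B t)))"

text \<open>The triconnected components of \<open>G\<close> are the graphs \<open>torso G T B t\<close> for the nodes \<open>t\<close> of \<open>T\<close>.\<close>

definition triconnected_decomposition :: "'a pair_pre_digraph \<Rightarrow> 't pair_pre_digraph \<Rightarrow> ('t \<Rightarrow> 'a set) \<Rightarrow> bool" where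
  "triconnected_decomposition G T B \<longleftrightarrow>
     tree_decomposition G T B \<and> canonical_decomposition G T B \<and> adhesion_at_most 2 T B \<and>
     (\<forall>t \<in> pverts T. k_connected 3 (torso G T B t) \<or> cycle_graph (torso G T B t) \<or>
        complete_digraph 2 (with_proj (torso G T B t)))"

section \<open>Trigraphs and twin-width\<close>

text \<open>Both edge relations are meant to be symmetric and irreflexive, and disjoint from each other.\<close>

record 'a trigraph =
  tverts :: "'a set"
  black :: "'a rel"
  red :: "'a rel"

text \<open>The vertex arising from the contraction of \<open>x\<close> and \<open>y\<close> reuses the name \<open>x\<close>.\<close>

definition contract :: "'a trigraph \<Rightarrow> 'a \<Rightarrow> 'a \<Rightarrow> 'a trigraph" where
  "contract H x y =
    (let R = tverts H - {x, y};
         N = {v \<in> R. (x, v) \<in> black H \<union> red H \<or> (y, v) \<in> black H \<union> red H};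
         C = {v \<in> R. (x, v) \<in> black H \<and> (y, v) \<in> black H}
     in \<lparr> tverts = insert x R,
          black = (black H \<inter> R \<times> R) \<union> {x} \<times> C \<union> C \<times> {x},
          red = (red H \<inter> R \<times> R) \<union> {x} \<times> (N - C) \<union> (N - C) \<times> {x} \<rparr>)"

definition contraction_sequence :: "'a trigraph \<Rightarrow> 'a trigraph list \<Rightarrow> bool" where
  "contraction_sequence H Hs \<longleftrightarrow>
     Hs \<noteq> [] \<and> hd Hs = H \<and> card (tverts (last Hs)) = 1 \<and>
     (\<forall>i. Suc i < length Hs \<longrightarrow>
       (\<exists>x \<in> tverts (Hs ! i). \<exists>y \<in> tverts (Hs ! i). x \<noteq> y \<and> Hs ! Suc i = contract (Hs ! i) x y))"

definition red_degree :: "'a trigraph \<Rightarrow> 'a \<Rightarrow> nat" where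
  "red_degree H v = card {u. (v, u) \<in> red H}"

definition sequence_width :: "'a trigraph list \<Rightarrow> nat" where
  "sequence_width Hs = (MAX H \<in> set Hs. MAX v \<in> tverts H. red_degree H v)"

definition tww :: "'a trigraph \<Rightarrow> nat" where
  "tww H = (LEAST d. \<exists>Hs. contraction_sequence H Hs \<and> sequence_width Hs = d)"

definition trigraph_of :: "'a pair_pre_digraph \<Rightarrow> 'a trigraph" where
  "trigraph_of G = \<lparr> tverts = pverts G, black = parcs G, red = {} \<rparr>"

definition red_torso :: "'a pair_pre_digraph \<Rightarrow> 't pair_pre_digraph \<Rightarrow> ('t \<Rightarrow> 'a set) \<Rightarrow> 't \<Rightarrow> 'a trigraph" where
  "red_torso G T B t =
     \<lparr> tverts = pverts (torso G T B t),
       black = parcs (torso G T B t) - virtual_edges T B t,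
       red = virtual_edges T B t \<rparr>"

end

theory Submission
  imports Defs "HOL-Library.Disjoint_Sets"
begin

text \<open>
  Root the tree \<open>T\<close>. For a node \<open>t\<close>, the vertices strictly below its parent adhesion set
  \<open>A\<close> are contracted, bottom-up, to one vertex for each of the at most four traces
  \<open>N(w) \<inter> A\<close>; this keeps all pairs with the vertices of \<open>A\<close> homogeneous, so sibling subtrees do
  not interfere with each other. Once the children of \<open>t\<close> are reduced, what remains of the child on
  a virtual edge \<open>uv\<close> becomes a ``gadget'' attached to \<open>u\<close> and \<open>v\<close>. A contraction sequence of the red
  torso is then followed on \<open>B\<^sub>t - A\<close> with every part split by its trace on \<open>A\<close>, while gadgets are
  merged as soon as their ends are. A gadget with two ends outside \<open>A\<close> has empty trace, so a part
  with \<open>d\<close> red neighbours in the torso sees at most \<open>4(d + 2)\<close> parts of the torso (\<open>d + 2\<close> rather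
  than \<open>d + 1\<close> because one contraction may be under way), \<open>d\<close> gadgets between two parts and \<open>4\<close>
  gadgets inside its own part, while a gadget sees at most \<open>18\<close> parts altogether. This gives red
  degree at most \<open>max (5d + 12) 18 \<le> max (8d + 6) 18\<close>.
\<close>

section \<open>Sequences of partitions\<close>

text \<open>A contraction sequence of \<open>G\<close> is handled as a chain of partitions of its
  vertex set: a part is a contracted vertex, and \<open>mixed\<close> parts are the red edges. No
  merges are scheduled by hand. For two partitions given by labels, every partition between them is
  shown to be \<open>narrow\<close> by counting labels, and then any order of merges will do. The
  red colour of virtual edges is what pays for the gadgets. As long as a map \<open>f\<close> keeps
  the ends of a red pair apart, their names are red neighbours in the quotient of the torso, so the
  two-ended gadget classes at a torso part are charged to its at most \<open>d\<close> red
  neighbours. The obstacle is that one contraction in the torso stands for many merges in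
  \<open>G\<close>: all trace classes of the two vertices and all gadgets on them have to follow.
  While this happens, old and new names coexist, and the bounds must hold for every mixture of the
  two.\<close>

definition mixed :: "'a rel \<Rightarrow> 'a set \<Rightarrow> 'a set \<Rightarrow> bool" where
  "mixed E X Y \<longleftrightarrow> (\<exists>x\<in>X. \<exists>y\<in>Y. (x, y) \<in> E) \<and> (\<exists>x\<in>X. \<exists>y\<in>Y. (x, y) \<notin> E)"

definition narrow :: "'a rel \<Rightarrow> nat \<Rightarrow> 'a set set \<Rightarrow> bool" where
  "narrow E D P \<longleftrightarrow> (\<forall>X\<in>P. card {Y \<in> P. Y \<noteq> X \<and> mixed E X Y} \<le> D)"

text \<open>Both ends of a step must be \<open>narrow\<close>, so a nonempty chain carries its own
  width bound. The empty chain carries none, and therefore \<open>narrow\<close> of the first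
  partition is requested separately when chains are turned into contraction sequences.\<close>

definition merge_step :: "'a rel \<Rightarrow> nat \<Rightarrow> 'a set set rel" where
  "merge_step E D = {(P, P'). narrow E D P \<and> narrow E D P' \<and>
     (\<exists>X\<in>P. \<exists>Y\<in>P. X \<noteq> Y \<and> P' = insert (X \<union> Y) (P - {X, Y}))}"

definition fibres :: "('a \<Rightarrow> 'b) \<Rightarrow> 'a set \<Rightarrow> 'a set set" where
  "fibres f S = (\<lambda>w. {v \<in> S. f v = f w}) ` S"

lemma mixed_sym: "sym E \<Longrightarrow> mixed E X Y \<Longrightarrow> mixed E Y X"
  unfolding mixed_def by (meson symD)

lemma mixed_mono: "mixed E X Y \<Longrightarrow> X \<subseteq> X' \<Longrightarrow> Y \<subseteq> Y' \<Longrightarrow> mixed E X' Y'"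
  unfolding mixed_def by blast

lemma not_mixed_singletons: "\<not> mixed E {x} {y}"
  by (auto simp: mixed_def)

lemma narrowI: "(\<And>X. X \<in> P \<Longrightarrow> card {Y \<in> P. Y \<noteq> X \<and> mixed E X Y} \<le> D) \<Longrightarrow> narrow E D P"
  by (simp add: narrow_def)

lemma merge_stepI:
  assumes "narrow E D P" "narrow E D P'" "X \<in> P" "Y \<in> P" "X \<noteq> Y"
    and "P' = insert (X \<union> Y) (P - {X, Y})"
  shows "(P, P') \<in> merge_step E D"
proof -
  have "\<exists>X\<in>P. \<exists>Y\<in>P. X \<noteq> Y \<and> P' = insert (X \<union> Y) (P - {X, Y})"
    using assms(3-6) by (intro bexI[of _ X] bexI[of _ Y] conjI)
  then show ?thesis using assms(1,2) by (simp add: merge_step_def)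
qed

lemma narrow_union:
  assumes "sym E" "narrow E D P" "narrow E D R" "\<And>X Y. X \<in> P \<Longrightarrow> Y \<in> R \<Longrightarrow> \<not> mixed E X Y"
  shows "narrow E D (P \<union> R)"
proof (rule narrowI)
  fix X assume "X \<in> P \<union> R"
  then consider "X \<in> P" | "X \<in> R" by blast
  then show "card {Y \<in> P \<union> R. Y \<noteq> X \<and> mixed E X Y} \<le> D"
  proof cases
    case 1
    then have "{Y \<in> P \<union> R. Y \<noteq> X \<and> mixed E X Y} = {Y \<in> P. Y \<noteq> X \<and> mixed E X Y}"
      using assms(4) by blast
    then show ?thesis using assms(2) 1 by (simp add: narrow_def)
  next
    case 2
    then have "{Y \<in> P \<union> R. Y \<noteq> X \<and> mixed E X Y} = {Y \<in> R. Y \<noteq> X \<and> mixed E X Y}"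
      using assms(4) mixed_sym[OF assms(1)] by blast
    then show ?thesis using assms(3) 2 by (simp add: narrow_def)
  qed
qed

lemma partition_on_fibres: "partition_on S (fibres f S)"
  by (rule partition_onI) (auto simp: fibres_def disjnt_def)

lemma refines_fibres:
  assumes "\<And>v w. v \<in> S \<Longrightarrow> w \<in> S \<Longrightarrow> f v = f w \<Longrightarrow> g v = g w"
  shows "refines S (fibres f S) (fibres g S)"
  unfolding refines_def
proof (intro conjI partition_on_fibres ballI)
  fix X assume "X \<in> fibres f S"
  then obtain w where "w \<in> S" "X = {v \<in> S. f v = f w}" by (auto simp: fibres_def)
  moreover have "{v \<in> S. f v = f w} \<subseteq> {v \<in> S. g v = g w}" using assms \<open>w \<in> S\<close> by blast
  ultimately show "\<exists>Y\<in>fibres g S. X \<subseteq> Y" unfolding fibres_def by blast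
qed

lemma fibres_cong: "(\<And>v w. v \<in> S \<Longrightarrow> w \<in> S \<Longrightarrow> f v = f w \<longleftrightarrow> g v = g w) \<Longrightarrow> fibres f S = fibres g S"
  unfolding fibres_def by (intro image_cong Collect_cong refl) blast

lemma fibres_inj: "inj_on f S \<Longrightarrow> fibres f S = (\<lambda>w. {w}) ` S"
  unfolding fibres_def by (intro image_cong refl) (auto dest: inj_onD)

lemma fibres_const: "S \<noteq> {} \<Longrightarrow> fibres (\<lambda>_. k) S = {S}"
  by (auto simp: fibres_def)

lemma fibres_Un:
  assumes "f ` S \<inter> f ` S' = {}"
  shows "fibres f (S \<union> S') = fibres f S \<union> fibres f S'"
  unfolding fibres_def image_Un
proof (intro arg_cong2[where f = "(\<union>)"] image_cong refl Collect_cong)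
  show "(v \<in> S \<union> S' \<and> f v = f w) = (v \<in> S \<and> f v = f w)" if "w \<in> S" for v w
    using assms that by (metis IntI UnE UnI1 empty_iff imageI)
  show "(v \<in> S \<union> S' \<and> f v = f w) = (v \<in> S' \<and> f v = f w)" if "w \<in> S'" for v w
    using assms that by (metis IntI UnE UnI2 empty_iff imageI)
qed

lemma partition_on_merge:
  assumes "partition_on V P" "X \<in> P" "Y \<in> P"
  shows "partition_on V (insert (X \<union> Y) (P - {X, Y}))"
proof (rule partition_onI)
  show "\<Union> (insert (X \<union> Y) (P - {X, Y})) = V"
    using assms by (auto simp: partition_on_def)
  show "{} \<notin> insert (X \<union> Y) (P - {X, Y})"
    using assms by (auto simp: partition_on_def)
  have *: "p \<inter> q = {}" if "p \<in> P" "q \<in> P" "p \<noteq> q" for p q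
    using assms(1) that by (auto simp: partition_on_def disjoint_def)
  have **: "(X \<union> Y) \<inter> q = {}" if "q \<in> P - {X, Y}" for q
    using that *[of X q] *[of Y q] assms(2,3) by blast
  show "disjnt p q" if "p \<in> insert (X \<union> Y) (P - {X, Y})" "q \<in> insert (X \<union> Y) (P - {X, Y})" "p \<noteq> q" for p q
    using that * ** unfolding disjnt_def by (metis Diff_iff inf_commute insert_iff)
qed

lemma refines_merge:
  assumes "partition_on V P" "X \<in> P" "Y \<in> P"
  shows "refines V P (insert (X \<union> Y) (P - {X, Y}))"
  unfolding refines_def
proof (intro conjI assms(1) partition_on_merge[OF assms] ballI)
  fix Z assume "Z \<in> P"
  then show "\<exists>W\<in>insert (X \<union> Y) (P - {X, Y}). Z \<subseteq> W"
    by (cases "Z = X \<or> Z = Y") auto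
qed

text \<open>Merging two parts of \<open>P\<close> that lie in one part of \<open>Q\<close> gives a
  partition still between \<open>P\<close> and \<open>Q\<close>, so the hypothesis applies again
  with fewer parts. Asking for the bound on all intermediate partitions makes the order of the
  merges irrelevant.\<close>

lemma coarsening_merges:
  assumes "finite V" "refines V P Q"
    and "\<And>M. refines V P M \<Longrightarrow> refines V M Q \<Longrightarrow> narrow E D M"
  shows "(P, Q) \<in> (merge_step E D)\<^sup>*"
  using assms(2,3)
proof (induction "card P" arbitrary: P rule: less_induct)
  case less
  have part: "partition_on V P" "partition_on V Q" and sub: "\<And>X. X \<in> P \<Longrightarrow> \<exists>Y\<in>Q. X \<subseteq> Y"
    using less.prems(1) unfolding refines_def by blast+
  have fin: "finite P" using part(1) assms(1) by (rule finite_elements[rotated])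
  show ?case
  proof (cases "\<exists>X\<in>P. \<exists>Y\<in>P. \<exists>Z\<in>Q. X \<noteq> Y \<and> X \<union> Y \<subseteq> Z")
    case True
    then obtain X Y Z where XY: "X \<in> P" "Y \<in> P" "X \<noteq> Y" "Z \<in> Q" "X \<union> Y \<subseteq> Z" by blast
    let ?P = "insert (X \<union> Y) (P - {X, Y})"
    have r1: "refines V P ?P" using refines_merge[OF part(1) XY(1,2)] .
    have r2: "refines V ?P Q"
      unfolding refines_def
    proof (intro conjI partition_on_merge[OF part(1) XY(1,2)] part(2) ballI)
      fix W assume "W \<in> ?P"
      then show "\<exists>Z\<in>Q. W \<subseteq> Z" using XY(4,5) sub by (cases "W = X \<union> Y") blast+
    qed
    have nar: "narrow E D P" "narrow E D ?P"
      using less.prems(2)[OF refines_refl[OF part(1)] less.prems(1)] less.prems(2)[OF r1 r2] .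
    have "card ?P \<le> Suc (card (P - {X, Y}))" using fin by (simp add: card_insert_if)
    also have "card (P - {X, Y}) = card P - 2" using XY(1-3) by (subst card_Diff_subset) auto
    also have "card P \<ge> 2" using XY(1-3) card_mono[OF fin, of "{X, Y}"] by simp
    then have "Suc (card P - 2) < card P" by simp
    finally have "card ?P < card P" .
    moreover have "narrow E D M" if "refines V ?P M" "refines V M Q" for M
      using less.prems(2)[OF refines_trans[OF r1 that(1)] that(2)] .
    ultimately have "(?P, Q) \<in> (merge_step E D)\<^sup>*" using less.hyps[OF _ r2] by simp
    moreover have "(P, ?P) \<in> merge_step E D" using nar XY(1-3) by (rule merge_stepI[OF _ _ _ _ _ refl])
    ultimately show ?thesis by (rule converse_rtrancl_into_rtrancl[rotated])
  next
    case False
    \<comment> \<open>If no part of \<open>Q\<close> contains two parts of \<open>P\<close>, each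
      part of \<open>Q\<close> is a union of just one of them.\<close>
    have "Q \<subseteq> P"
    proof
      fix Z assume Z: "Z \<in> Q"
      have pZ: "partition_on Z {p \<in> P. p \<subseteq> Z}"
        using refines_obtains_subset[OF less.prems(1) Z] .
      obtain z where "z \<in> Z" using partition_onD3[OF part(2)] Z by (metis ex_in_conv)
      then obtain X where X: "X \<in> P" "X \<subseteq> Z" using partition_onD1[OF pZ] by blast
      have "p = X" if "p \<in> P" "p \<subseteq> Z" for p
        using False Z X that by (meson Un_least)
      then have "{p \<in> P. p \<subseteq> Z} = {X}" using X by blast
      then show "Z \<in> P" using partition_onD1[OF pZ] X(1) by simp
    qed
    then have "refines V Q P" unfolding refines_def using part by blast
    then have "P = Q" using less.prems(1) by (intro refines_asym)
    then show ?thesis by simp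
  qed
qed

lemma merges_frame:
  assumes "(P, Q) \<in> (merge_step E D)\<^sup>*" "partition_on I P"
    and "sym E" "narrow E D R" "\<And>X Z. X \<in> R \<Longrightarrow> Z \<in> Q \<Longrightarrow> \<not> mixed E Z X"
    and "\<And>X. X \<in> R \<Longrightarrow> X \<inter> I = {}"
  shows "(P \<union> R, Q \<union> R) \<in> (merge_step E D)\<^sup>*"
proof -
  have "refines I P Q \<and> (P \<union> R, Q \<union> R) \<in> (merge_step E D)\<^sup>*"
    using assms(1,2)
  proof (induction rule: converse_rtrancl_induct)
    case base
    then show ?case by (simp add: refines_refl)
  next
    case (step P P')
    then obtain X Y where XY: "narrow E D P" "narrow E D P'" "X \<in> P" "Y \<in> P" "X \<noteq> Y"
      "P' = insert (X \<union> Y) (P - {X, Y})" unfolding merge_step_def by blast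
    have r: "refines I P P'" unfolding XY(6) using step.prems XY(3,4) by (rule refines_merge)
    then have part': "partition_on I P'" by (simp add: refines_def)
    have r': "refines I P' Q" and m: "(P' \<union> R, Q \<union> R) \<in> (merge_step E D)\<^sup>*"
      using step.IH part' by auto
    have nm: "\<not> mixed E Z W" if "refines I M Q" "Z \<in> M" "W \<in> R" for M Z W
      using that assms(5) mixed_mono[of E Z W] by (meson refines_def subset_refl)
    have rPQ: "refines I P Q" using refines_trans[OF r r'] .
    have "narrow E D (P \<union> R)" "narrow E D (P' \<union> R)"
      using narrow_union[OF assms(3) XY(1) assms(4) nm[OF rPQ]]
        narrow_union[OF assms(3) XY(2) assms(4) nm[OF r']] by simp_all
    moreover have "X \<notin> R" "Y \<notin> R"
      using XY(3,4) assms(6) partition_onD1[OF step.prems] partition_onD3[OF step.prems]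
      by (metis Int_absorb2 Union_upper)+
    then have "P' \<union> R = insert (X \<union> Y) (P \<union> R - {X, Y})" unfolding XY(6) by blast
    ultimately have "(P \<union> R, P' \<union> R) \<in> merge_step E D"
      using XY by (intro merge_stepI[of _ _ _ _ X Y]) auto
    then show ?case using rPQ m by (meson converse_rtrancl_into_rtrancl)
  qed
  then show ?thesis by simp
qed

text \<open>Vertices with equal labels share a part of \<open>M\<close>, so different parts have no
  label in common, and choosing one label in \<open>T\<close> for each part is injective. All
  numerical degree bounds below are obtained by this count.\<close>

lemma card_parts_le:
  assumes "refines V (fibres L V) M" "S \<subseteq> M" "finite T" "\<And>Y. Y \<in> S \<Longrightarrow> \<exists>y\<in>Y. L y \<in> T"
  shows "card S \<le> card T"
proof -
  obtain r where r: "\<And>Y. Y \<in> S \<Longrightarrow> r Y \<in> Y \<and> L (r Y) \<in> T"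
    using bchoice[of S "\<lambda>Y y. y \<in> Y \<and> L y \<in> T"] assms(4) by blast
  have inV: "Y \<subseteq> V" if "Y \<in> M" for Y
    using assms(1) that by (auto simp: refines_def partition_on_def)
  have "inj_on (L \<circ> r) S"
  proof (rule inj_onI)
    fix Y Z assume YZ: "Y \<in> S" "Z \<in> S" "(L \<circ> r) Y = (L \<circ> r) Z"
    have rV: "r Y \<in> V" "r Z \<in> V" using r[OF YZ(1)] r[OF YZ(2)] YZ(1,2) inV assms(2) by auto
    then have "{v \<in> V. L v = L (r Y)} \<in> fibres L V" by (auto simp: fibres_def)
    then obtain W where W: "W \<in> M" "{v \<in> V. L v = L (r Y)} \<subseteq> W"
      using assms(1) unfolding refines_def by (elim conjE) (drule (1) bspec, blast)
    then have "r Y \<in> W" "r Z \<in> W" using rV YZ by auto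
    moreover have "A = W" if "A \<in> M" "a \<in> A" "a \<in> W" for A a
    proof (rule ccontr)
      assume "A \<noteq> W"
      moreover have "disjoint M" using assms(1) by (simp add: refines_def partition_on_def)
      ultimately have "A \<inter> W = {}" using disjointD[of M A W] that(1) W(1) by simp
      then show False using that by blast
    qed
    ultimately have "Y = W" "Z = W" using r[OF YZ(1)] r[OF YZ(2)] YZ(1,2) assms(2) by auto
    then show "Y = Z" by simp
  qed
  moreover have "(L \<circ> r) ` S \<subseteq> T" using r by auto
  ultimately show ?thesis using assms(3) card_inj_on_le by blast
qed

section \<open>Quotient trigraphs\<close>

definition wf_trigraph :: "'a trigraph \<Rightarrow> bool" where
  "wf_trigraph H \<longleftrightarrow> finite (tverts H) \<and> tverts H \<noteq> {} \<and> sym (black H) \<and> sym (red H) \<and>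
     irrefl (black H) \<and> irrefl (red H) \<and> black H \<inter> red H = {} \<and>
     black H \<union> red H \<subseteq> tverts H \<times> tverts H"

definition all_black :: "'a trigraph \<Rightarrow> ('a \<Rightarrow> 'a) \<Rightarrow> 'a \<Rightarrow> 'a \<Rightarrow> bool" where
  "all_black H f a b \<longleftrightarrow> (\<forall>u\<in>tverts H. \<forall>v\<in>tverts H. f u = a \<longrightarrow> f v = b \<longrightarrow> (u, v) \<in> black H)"

definition some_edge :: "'a trigraph \<Rightarrow> ('a \<Rightarrow> 'a) \<Rightarrow> 'a \<Rightarrow> 'a \<Rightarrow> bool" where
  "some_edge H f a b \<longleftrightarrow> (\<exists>u\<in>tverts H. \<exists>v\<in>tverts H. f u = a \<and> f v = b \<and> (u, v) \<in> black H \<union> red H)"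

text \<open>A whole history of contractions is recorded by one map: \<open>f v\<close> is the
  current name of the vertex into which \<open>v\<close> has been contracted.\<close>

definition quot :: "'a trigraph \<Rightarrow> ('a \<Rightarrow> 'a) \<Rightarrow> 'a trigraph" where
  "quot H f = \<lparr> tverts = f ` tverts H,
     black = {(a, b). a \<in> f ` tverts H \<and> b \<in> f ` tverts H \<and> a \<noteq> b \<and> all_black H f a b},
     red = {(a, b). a \<in> f ` tverts H \<and> b \<in> f ` tverts H \<and> a \<noteq> b \<and> some_edge H f a b \<and> \<not> all_black H f a b} \<rparr>"

text \<open>Follows the convention of \<open>contract\<close> that the merged vertex keeps the name
  \<open>x\<close>.\<close>

definition identify :: "'a \<Rightarrow> 'a \<Rightarrow> ('b \<Rightarrow> 'a) \<Rightarrow> 'b \<Rightarrow> 'a" where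
  "identify x y f v = (if f v = y then x else f v)"

lemma quot_simps [simp]:
  "tverts (quot H f) = f ` tverts H"
  "(a, b) \<in> black (quot H f) \<longleftrightarrow> a \<in> f ` tverts H \<and> b \<in> f ` tverts H \<and> a \<noteq> b \<and> all_black H f a b"
  "(a, b) \<in> red (quot H f) \<longleftrightarrow>
     a \<in> f ` tverts H \<and> b \<in> f ` tverts H \<and> a \<noteq> b \<and> some_edge H f a b \<and> \<not> all_black H f a b"
  by (auto simp: quot_def)

lemma all_black_sym: "sym (black H) \<Longrightarrow> all_black H f a b \<longleftrightarrow> all_black H f b a"
  unfolding all_black_def by (meson symD)

lemma some_edge_sym:
  "sym (black H) \<Longrightarrow> sym (red H) \<Longrightarrow> some_edge H f a b \<longleftrightarrow> some_edge H f b a"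
  unfolding some_edge_def Un_iff by (metis symD)

lemma all_black_imp_some_edge:
  "a \<in> f ` tverts H \<Longrightarrow> b \<in> f ` tverts H \<Longrightarrow> all_black H f a b \<Longrightarrow> some_edge H f a b"
  unfolding all_black_def some_edge_def by blast

lemma identify_eq_iff:
  "x \<noteq> y \<Longrightarrow> identify x y f v = x \<longleftrightarrow> f v = x \<or> f v = y"
  "a \<noteq> x \<Longrightarrow> identify x y f v = a \<longleftrightarrow> a \<noteq> y \<and> f v = a"
  by (auto simp: identify_def)

lemma image_identify: "x \<in> f ` S \<Longrightarrow> x \<noteq> y \<Longrightarrow> identify x y f ` S = f ` S - {y}"
  by (auto simp: identify_def)

lemma all_black_identify:
  assumes "x \<noteq> y"
  shows "a \<noteq> x \<Longrightarrow> b \<noteq> x \<Longrightarrow> a \<noteq> y \<Longrightarrow> b \<noteq> y \<Longrightarrow>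
      all_black H (identify x y f) a b \<longleftrightarrow> all_black H f a b"
    and "b \<noteq> x \<Longrightarrow> b \<noteq> y \<Longrightarrow>
      all_black H (identify x y f) x b \<longleftrightarrow> all_black H f x b \<and> all_black H f y b"
  using assms unfolding all_black_def by (auto simp: identify_eq_iff)

lemma some_edge_identify:
  assumes "x \<noteq> y"
  shows "a \<noteq> x \<Longrightarrow> b \<noteq> x \<Longrightarrow> a \<noteq> y \<Longrightarrow> b \<noteq> y \<Longrightarrow>
      some_edge H (identify x y f) a b \<longleftrightarrow> some_edge H f a b"
    and "b \<noteq> x \<Longrightarrow> b \<noteq> y \<Longrightarrow>
      some_edge H (identify x y f) x b \<longleftrightarrow> some_edge H f x b \<or> some_edge H f y b"
  using assms unfolding some_edge_def by (simp_all add: identify_eq_iff) blast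

text \<open>The rule of \<open>contract\<close> is local, that of \<open>quot\<close> looks at all
  original pairs. They agree because a union of two fibres is entirely black to a third one iff both
  are, and has an edge to it iff one of them has. Only the row and the column of \<open>x\<close>
  change.\<close>

lemma contract_quot:
  assumes "wf_trigraph H" "x \<in> f ` tverts H" "y \<in> f ` tverts H" "x \<noteq> y"
  shows "contract (quot H f) x y = quot H (identify x y f)"
proof -
  have s: "sym (black H)" "sym (red H)" using assms(1) by (auto simp: wf_trigraph_def)
  define R where "R = f ` tverts H - {x, y}"
  define C where "C = {v \<in> R. all_black H f x v \<and> all_black H f y v}"
  define N where "N = {v \<in> R. some_edge H f x v \<or> some_edge H f y v}"
  have CN: "C = {v \<in> R. (x, v) \<in> black (quot H f) \<and> (y, v) \<in> black (quot H f)}"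
    "N = {v \<in> R. (x, v) \<in> black (quot H f) \<union> red (quot H f) \<or> (y, v) \<in> black (quot H f) \<union> red (quot H f)}"
    unfolding C_def N_def using assms(2,3) all_black_imp_some_edge[of _ f H]
    by (auto simp: R_def)
  have contr: "contract (quot H f) x y = \<lparr> tverts = insert x R,
      black = (black (quot H f) \<inter> R \<times> R) \<union> {x} \<times> C \<union> C \<times> {x},
      red = (red (quot H f) \<inter> R \<times> R) \<union> {x} \<times> (N - C) \<union> (N - C) \<times> {x} \<rparr>"
    unfolding contract_def CN Let_def by (simp add: R_def)
  have CN': "C \<subseteq> R" "N \<subseteq> R" by (auto simp: C_def N_def)
  have img: "identify x y f ` tverts H = insert x R"
    using assms(2,4) by (auto simp: image_identify R_def)
  have xR: "x \<notin> R" "y \<notin> R" "R \<subseteq> f ` tverts H" by (auto simp: R_def)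
  have C: "v \<in> C \<longleftrightarrow> v \<in> R \<and> all_black H (identify x y f) x v" for v
    using xR all_black_identify(2)[OF assms(4), of v H f] by (auto simp: C_def)
  have N: "v \<in> N \<longleftrightarrow> v \<in> R \<and> some_edge H (identify x y f) x v" for v
    using xR some_edge_identify(2)[OF assms(4), of v H f] by (auto simp: N_def)
  have RR: "all_black H (identify x y f) a b \<longleftrightarrow> all_black H f a b"
    "some_edge H (identify x y f) a b \<longleftrightarrow> some_edge H f a b" if "a \<in> R" "b \<in> R" for a b
    using that xR all_black_identify(1)[OF assms(4), of a b H f]
      some_edge_identify(1)[OF assms(4), of a b H f] by auto
  let ?f = "identify x y f"
  have sym: "all_black H ?f a x \<longleftrightarrow> all_black H ?f x a" "some_edge H ?f a x \<longleftrightarrow> some_edge H ?f x a" for a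
    using all_black_sym[OF s(1)] some_edge_sym[OF s] by blast+
  have q: "(a, b) \<in> black (quot H ?f) \<longleftrightarrow> a \<in> insert x R \<and> b \<in> insert x R \<and> a \<noteq> b \<and> all_black H ?f a b"
    "(a, b) \<in> red (quot H ?f) \<longleftrightarrow>
      a \<in> insert x R \<and> b \<in> insert x R \<and> a \<noteq> b \<and> some_edge H ?f a b \<and> \<not> all_black H ?f a b" for a b
    by (simp_all only: quot_simps img)
  have "(a, b) \<in> (black (quot H f) \<inter> R \<times> R) \<union> {x} \<times> C \<union> C \<times> {x} \<longleftrightarrow> (a, b) \<in> black (quot H ?f)"
    "(a, b) \<in> (red (quot H f) \<inter> R \<times> R) \<union> {x} \<times> (N - C) \<union> (N - C) \<times> {x} \<longleftrightarrow> (a, b) \<in> red (quot H ?f)" for a b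
  proof -
    consider "a = x" "b = x" | "a = x" "b \<noteq> x" | "a \<noteq> x" "b = x" | "a \<notin> R" "a \<noteq> x" | "b \<notin> R" "b \<noteq> x"
      | "a \<in> R" "b \<in> R" "a \<noteq> x" "b \<noteq> x" by blast
    then have "((a, b) \<in> (black (quot H f) \<inter> R \<times> R) \<union> {x} \<times> C \<union> C \<times> {x} \<longleftrightarrow> (a, b) \<in> black (quot H ?f)) \<and>
      ((a, b) \<in> (red (quot H f) \<inter> R \<times> R) \<union> {x} \<times> (N - C) \<union> (N - C) \<times> {x} \<longleftrightarrow> (a, b) \<in> red (quot H ?f))"
    proof cases
      case 1
      then show ?thesis using xR(1) CN' unfolding q 1 by blast
    next
      case 2
      then show ?thesis using xR(1) unfolding q 2(1) by (simp add: C N del: quot_simps) blast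
    next
      case 3
      then show ?thesis using xR(1) unfolding q 3(2) sym by (simp add: C N del: quot_simps) blast
    next
      case 4
      then show ?thesis using CN' unfolding q by blast
    next
      case 5
      then show ?thesis using CN' unfolding q by blast
    next
      case 6
      then show ?thesis using xR(3) RR[OF 6(1,2)] unfolding q by auto
    qed
    then show "(a, b) \<in> (black (quot H f) \<inter> R \<times> R) \<union> {x} \<times> C \<union> C \<times> {x} \<longleftrightarrow> (a, b) \<in> black (quot H ?f)"
      "(a, b) \<in> (red (quot H f) \<inter> R \<times> R) \<union> {x} \<times> (N - C) \<union> (N - C) \<times> {x} \<longleftrightarrow> (a, b) \<in> red (quot H ?f)" by blast+
  qed
  then have "(black (quot H f) \<inter> R \<times> R) \<union> {x} \<times> C \<union> C \<times> {x} = black (quot H ?f)"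
    "(red (quot H f) \<inter> R \<times> R) \<union> {x} \<times> (N - C) \<union> (N - C) \<times> {x} = red (quot H ?f)"
    by (intro set_eqI, simp only: split_paired_all)+
  then show ?thesis unfolding contr using img by (simp add: quot_def)
qed

lemma quot_id:
  assumes "wf_trigraph H" shows "quot H id = H"
proof -
  have "all_black H id a b \<longleftrightarrow> (a, b) \<in> black H"
    "some_edge H id a b \<longleftrightarrow> (a, b) \<in> black H \<union> red H" if "a \<in> tverts H" "b \<in> tverts H" for a b
    using that by (auto simp: all_black_def some_edge_def)
  then have "black (quot H id) = black H" "red (quot H id) = red H"
    using assms unfolding wf_trigraph_def irrefl_def set_eq_iff split_paired_all by auto
  then show ?thesis by (simp add: quot_def)
qed

text \<open>Carries an invariant of name maps along a given sequence. Membership of both quotients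
  in \<open>Hs\<close> is handed to the step, so that the width of the sequence bounds their red
  degrees there.\<close>

lemma contraction_sequence_induct [consumes 2, case_names id identify]:
  assumes "contraction_sequence H Hs" "wf_trigraph H" "P id"
    and "\<And>f x y. P f \<Longrightarrow> x \<in> f ` tverts H \<Longrightarrow> y \<in> f ` tverts H \<Longrightarrow> x \<noteq> y \<Longrightarrow> quot H f \<in> set Hs \<Longrightarrow>
      quot H (identify x y f) \<in> set Hs \<Longrightarrow> P (identify x y f)"
  shows "\<forall>H'\<in>set Hs. \<exists>f. H' = quot H f \<and> P f"
proof -
  have hd: "Hs \<noteq> []" "Hs ! 0 = H" using assms(1) by (auto simp: contraction_sequence_def hd_conv_nth)
  have "\<exists>f. Hs ! i = quot H f \<and> P f" if "i < length Hs" for i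
    using that
  proof (induction i)
    case 0
    then show ?case using hd quot_id[OF assms(2)] assms(3) by metis
  next
    case (Suc i)
    then obtain f where f: "Hs ! i = quot H f" "P f" by auto
    obtain x y where xy: "x \<in> tverts (Hs ! i)" "y \<in> tverts (Hs ! i)" "x \<noteq> y"
      "Hs ! Suc i = contract (Hs ! i) x y"
      using assms(1) Suc.prems unfolding contraction_sequence_def by blast
    have *: "x \<in> f ` tverts H" "y \<in> f ` tverts H" using xy f by auto
    have eq: "Hs ! Suc i = quot H (identify x y f)"
      using contract_quot[OF assms(2) * xy(3)] xy(4) f(1) by simp
    have "quot H f \<in> set Hs" "quot H (identify x y f) \<in> set Hs"
      using Suc.prems f(1) eq by (metis nth_mem Suc_lessD)+
    then show ?case using eq assms(4)[OF f(2) * xy(3)] by blast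
  qed
  then show ?thesis by (metis in_set_conv_nth)
qed

text \<open>Without some sequence the \<open>LEAST\<close> in \<open>tww\<close> would be
  meaningless; with one, the minimum is attained.\<close>

lemma contraction_sequence_exists:
  "finite (tverts H) \<Longrightarrow> tverts H \<noteq> {} \<Longrightarrow> \<exists>Hs. contraction_sequence H Hs"
proof (induction "card (tverts H)" arbitrary: H rule: less_induct)
  case less
  show ?case
  proof (cases "card (tverts H) = 1")
    case True
    then have "contraction_sequence H [H]" by (simp add: contraction_sequence_def)
    then show ?thesis ..
  next
    case False
    obtain x where x: "x \<in> tverts H" using less.prems by blast
    obtain y where y: "y \<in> tverts H" "y \<noteq> x"
      using False x is_singletonI' is_singleton_altdef by (metis less.prems(2))
    have tv: "tverts (contract H x y) = tverts H - {y}"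
      using x y by (auto simp: contract_def Let_def)
    then have "card (tverts (contract H x y)) < card (tverts H)"
      using y less.prems by (metis card_Diff1_less)
    moreover have "finite (tverts (contract H x y))" "tverts (contract H x y) \<noteq> {}"
      using tv less.prems x y by auto
    ultimately obtain Hs where Hs: "contraction_sequence (contract H x y) Hs"
      using less.hyps by blast
    have "contraction_sequence H (H # Hs)"
      unfolding contraction_sequence_def
    proof (intro conjI allI impI)
      fix i assume i: "Suc i < length (H # Hs)"
      show "\<exists>x\<in>tverts ((H # Hs) ! i). \<exists>y\<in>tverts ((H # Hs) ! i). x \<noteq> y \<and> (H # Hs) ! Suc i = contract ((H # Hs) ! i) x y"
      proof (cases i)
        case 0
        then show ?thesis using Hs x y(1) y(2)[symmetric]
          by (auto simp: contraction_sequence_def hd_conv_nth[symmetric])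
      next
        case (Suc j)
        then show ?thesis using Hs i by (simp add: contraction_sequence_def)
      qed
    qed (use Hs in \<open>auto simp: contraction_sequence_def\<close>)
    then show ?thesis ..
  qed
qed

lemma sequence_width_le_iff:
  assumes "contraction_sequence H Hs" "wf_trigraph H"
  shows "sequence_width Hs \<le> d \<longleftrightarrow> (\<forall>H'\<in>set Hs. \<forall>v\<in>tverts H'. red_degree H' v \<le> d)"
proof -
  have "\<forall>H'\<in>set Hs. \<exists>f. H' = quot H f \<and> True"
    by (rule contraction_sequence_induct[OF assms]) auto
  then have "finite (tverts H') \<and> tverts H' \<noteq> {}" if "H' \<in> set Hs" for H'
    using assms(2) that by (fastforce simp: wf_trigraph_def)
  moreover have "Hs \<noteq> []" using assms(1) by (simp add: contraction_sequence_def)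
  ultimately show ?thesis unfolding sequence_width_def by (simp add: Max_le_iff)
qed

lemma tww_le:
  "contraction_sequence H Hs \<Longrightarrow> sequence_width Hs \<le> d \<Longrightarrow> tww H \<le> d"
  unfolding tww_def by (rule order_trans[OF Least_le]) blast+

lemma tww_attained:
  assumes "wf_trigraph H"
  obtains Hs where "contraction_sequence H Hs" "sequence_width Hs = tww H"
proof -
  have "\<exists>d Hs. contraction_sequence H Hs \<and> sequence_width Hs = d"
    using contraction_sequence_exists[of H] assms by (auto simp: wf_trigraph_def)
  from LeastI_ex[OF this] show ?thesis using that unfolding tww_def by blast
qed

section \<open>From merges of parts to contractions of trigraphs\<close>

lemma fibres_identify:
  fixes f :: "'b \<Rightarrow> 'a"
  assumes "x \<noteq> y" "x \<in> f ` V" "y \<in> f ` V"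
  defines "X \<equiv> {v \<in> V. f v = x}" and "Y \<equiv> {v \<in> V. f v = y}"
  shows "fibres (identify x y f) V = insert (X \<union> Y) (fibres f V - {X, Y})"
proof -
  have fib: "fibres g V = (\<lambda>a. {v \<in> V. g v = a}) ` (g ` V)" for g :: "'b \<Rightarrow> 'a"
    by (simp add: fibres_def image_image)
  have inj: "inj_on (\<lambda>a. {v \<in> V. f v = a}) (f ` V)" by (rule inj_onI) blast
  have "identify x y f ` V = insert x (f ` V - {x, y})"
    using assms by (auto simp: image_identify)
  then have "fibres (identify x y f) V =
      insert {v \<in> V. identify x y f v = x} ((\<lambda>a. {v \<in> V. identify x y f v = a}) ` (f ` V - {x, y}))"
    unfolding fib by simp
  also have "{v \<in> V. identify x y f v = x} = X \<union> Y"
    using assms(1) by (auto simp: identify_eq_iff X_def Y_def)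
  also have "(\<lambda>a. {v \<in> V. identify x y f v = a}) ` (f ` V - {x, y}) = (\<lambda>a. {v \<in> V. f v = a}) ` (f ` V - {x, y})"
    by (intro image_cong refl) (auto simp: identify_eq_iff)
  also have "\<dots> = fibres f V - {X, Y}"
    unfolding fib using inj_on_image_set_diff[OF inj, of "f ` V" "{x, y}"] assms by (simp add: X_def Y_def)
  finally show ?thesis .
qed

text \<open>As \<open>H\<close> has no red edge, a red edge of the quotient comes from one adjacent
  and one non-adjacent pair across two fibres, which are thus mixed. Different names have different
  fibres, so nothing is counted twice.\<close>

lemma red_degree_quot_le:
  assumes "narrow E D (fibres f (tverts H))" "black H = E" "red H = {}" "finite (tverts H)"
    and "a \<in> f ` tverts H"
  shows "red_degree (quot H f) a \<le> D"
proof -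
  let ?F = "\<lambda>b. {v \<in> tverts H. f v = b}"
  let ?P = "fibres f (tverts H)"
  have FP: "?F b \<in> ?P" if "b \<in> f ` tverts H" for b
    using that by (auto simp: fibres_def)
  have "?F b \<in> {Y \<in> ?P. Y \<noteq> ?F a \<and> mixed E (?F a) Y}" if "(a, b) \<in> red (quot H f)" for b
  proof -
    have b: "b \<in> f ` tverts H" "a \<noteq> b" "some_edge H f a b" "\<not> all_black H f a b"
      using that by simp_all
    obtain u v where "u \<in> ?F a" "v \<in> ?F b" "(u, v) \<in> E"
      using b(3) assms(2,3) unfolding some_edge_def by blast
    moreover obtain u' v' where "u' \<in> ?F a" "v' \<in> ?F b" "(u', v') \<notin> E"
      using b(4) assms(2) unfolding all_black_def by blast
    ultimately have "mixed E (?F a) (?F b)" unfolding mixed_def by blast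
    moreover have "v \<notin> ?F a" using \<open>v \<in> ?F b\<close> b(2) by simp
    with \<open>v \<in> ?F b\<close> have "?F b \<noteq> ?F a" by (rule_tac notI) simp
    ultimately show ?thesis using FP[OF b(1)] by blast
  qed
  then have img: "?F ` {b. (a, b) \<in> red (quot H f)} \<subseteq> {Y \<in> ?P. Y \<noteq> ?F a \<and> mixed E (?F a) Y}"
    by blast
  have fin: "finite {Y \<in> ?P. Y \<noteq> ?F a \<and> mixed E (?F a) Y}" using assms(4) by (simp add: fibres_def)
  have inj: "inj_on ?F {b. (a, b) \<in> red (quot H f)}"
  proof (rule inj_onI)
    fix b b' assume "b \<in> {b. (a, b) \<in> red (quot H f)}" "?F b = ?F b'"
    moreover from this(1) obtain v where "v \<in> ?F b" by auto
    ultimately have "v \<in> ?F b" "v \<in> ?F b'" by simp_all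
    then show "b = b'" by simp
  qed
  have "card {b. (a, b) \<in> red (quot H f)} \<le> card {Y \<in> ?P. Y \<noteq> ?F a \<and> mixed E (?F a) Y}"
    using card_inj_on_le[OF inj img fin] .
  also have "\<dots> \<le> D" using bspec[OF assms(1)[unfolded narrow_def] FP[OF assms(5)]] .
  finally show ?thesis by (simp add: red_degree_def)
qed

text \<open>The chain is consumed from its front, so the map naming the parts is generalised: after
  the first merge it becomes \<open>identify (f u) (f v) f\<close> for representatives
  \<open>u\<close>, \<open>v\<close> of the merged parts.\<close>

lemma merges_imp_contractions:
  assumes "wf_trigraph H" "black H = E" "red H = {}"
    and "(P, {tverts H}) \<in> (merge_step E D)\<^sup>*" "narrow E D P" "P = fibres f (tverts H)"
  shows "\<exists>Hs. contraction_sequence (quot H f) Hs \<and> (\<forall>H'\<in>set Hs. \<forall>v\<in>tverts H'. red_degree H' v \<le> D)"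
  using assms(4-6)
proof (induction arbitrary: f rule: converse_rtrancl_induct)
  case base
  let ?V = "tverts H"
  have V: "finite ?V" "?V \<noteq> {}" using assms(1) by (auto simp: wf_trigraph_def)
  then obtain v where v: "v \<in> ?V" by blast
  have "{w \<in> ?V. f w = f v} \<in> fibres f ?V" using v by (auto simp: fibres_def)
  then have "{w \<in> ?V. f w = f v} = ?V" using base(2) by auto
  then have "f ` ?V = {f v}" using v by blast
  then have "contraction_sequence (quot H f) [quot H f]" by (simp add: contraction_sequence_def)
  moreover have "red_degree (quot H f) a \<le> D" if "a \<in> f ` ?V" for a
    using red_degree_quot_le[of E D f H] base assms(2,3) V that by simp
  ultimately show ?case by (intro exI[of _ "[quot H f]"]) simp
next
  case (step P P')
  let ?V = "tverts H"
  have V: "finite ?V" "?V \<noteq> {}" using assms(1) by (auto simp: wf_trigraph_def)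
  obtain X Y where XY: "X \<in> P" "Y \<in> P" "X \<noteq> Y" "P' = insert (X \<union> Y) (P - {X, Y})" "narrow E D P'"
    using step.hyps(1) unfolding merge_step_def by blast
  obtain u v where uv: "u \<in> ?V" "v \<in> ?V" "X = {w \<in> ?V. f w = f u}" "Y = {w \<in> ?V. f w = f v}"
    using XY(1,2) step.prems(2) by (auto simp: fibres_def)
  have ne: "f u \<noteq> f v" using XY(3) uv by auto
  have "P' = fibres (identify (f u) (f v) f) ?V"
    unfolding XY(4) step.prems(2) uv(3,4)
    by (rule fibres_identify[OF ne, symmetric]) (use uv in auto)
  then obtain Hs where Hs: "contraction_sequence (quot H (identify (f u) (f v) f)) Hs"
    "\<forall>H'\<in>set Hs. \<forall>v\<in>tverts H'. red_degree H' v \<le> D"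
    using step.IH[OF XY(5)] by blast
  have "contraction_sequence (quot H f) (quot H f # Hs)"
    unfolding contraction_sequence_def
  proof (intro conjI allI impI)
    fix i assume i: "Suc i < length (quot H f # Hs)"
    show "\<exists>x\<in>tverts ((quot H f # Hs) ! i). \<exists>y\<in>tverts ((quot H f # Hs) ! i). x \<noteq> y \<and>
        (quot H f # Hs) ! Suc i = contract ((quot H f # Hs) ! i) x y"
    proof (cases i)
      case 0
      have "Hs ! 0 = contract (quot H f) (f u) (f v)"
        using Hs(1) contract_quot[OF assms(1) _ _ ne] uv
        by (auto simp: contraction_sequence_def hd_conv_nth[symmetric])
      then show ?thesis using 0 uv ne by auto
    next
      case (Suc j)
      then show ?thesis using Hs(1) i by (simp add: contraction_sequence_def)
    qed
  qed (use Hs in \<open>auto simp: contraction_sequence_def\<close>)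
  moreover have "red_degree (quot H f) a \<le> D" if "a \<in> f ` ?V" for a
    using red_degree_quot_le[of E D f H] step.prems assms(2,3) V that by simp
  ultimately show ?case using Hs(2) by (intro exI[of _ "quot H f # Hs"]) auto
qed

lemma tww_le_merges:
  assumes "wf_trigraph H" "red H = {}" "narrow (black H) D ((\<lambda>v. {v}) ` tverts H)"
    and "((\<lambda>v. {v}) ` tverts H, {tverts H}) \<in> (merge_step (black H) D)\<^sup>*"
  shows "tww H \<le> D"
proof -
  have "(\<lambda>v. {v}) ` tverts H = fibres id (tverts H)"
    by (rule fibres_inj[symmetric]) simp
  from merges_imp_contractions[OF assms(1) refl assms(2,4,3) this] obtain Hs where Hs: "contraction_sequence (quot H id) Hs"
    "\<forall>H'\<in>set Hs. \<forall>v\<in>tverts H'. red_degree H' v \<le> D"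
    by blast
  have seq: "contraction_sequence H Hs" using Hs(1) unfolding quot_id[OF assms(1)] .
  then have "sequence_width Hs \<le> D" using Hs(2) sequence_width_le_iff[OF seq assms(1)] by simp
  with seq show ?thesis by (rule tww_le)
qed

section \<open>A single bag\<close>

lemma narrow_singletons: "narrow E D ((\<lambda>v. {v}) ` V)"
proof (rule narrowI)
  fix X assume "X \<in> (\<lambda>v. {v}) ` V"
  then have "\<not> mixed E X Y" if "Y \<in> (\<lambda>v. {v}) ` V" for Y
    using that not_mixed_singletons[of E] by (elim imageE) simp
  then have "{Y \<in> (\<lambda>v. {v}) ` V. Y \<noteq> X \<and> mixed E X Y} = {}" by simp
  then show "card {Y \<in> (\<lambda>v. {v}) ` V. Y \<noteq> X \<and> mixed E X Y} \<le> D" by (simp only: card.empty)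
qed

lemma narrow_subset:
  assumes "narrow E D P" "R \<subseteq> P" "finite P"
  shows "narrow E D R"
proof (rule narrowI)
  fix X assume "X \<in> R"
  have "card {Y \<in> R. Y \<noteq> X \<and> mixed E X Y} \<le> card {Y \<in> P. Y \<noteq> X \<and> mixed E X Y}"
    using assms(2,3) by (intro card_mono) auto
  then show "card {Y \<in> R. Y \<noteq> X \<and> mixed E X Y} \<le> D"
    using assms(1,2) \<open>X \<in> R\<close> unfolding narrow_def by (meson order_trans subsetD)
qed

lemma refines_fibresD:
  assumes "refines V M (fibres L V)" "X \<in> M" "x \<in> X" "y \<in> X"
  shows "x \<in> V" "L x = L y"
proof -
  obtain Z where Z: "Z \<in> fibres L V" "X \<subseteq> Z" using assms(1,2) unfolding refines_def by blast
  then obtain w where "Z = {v \<in> V. L v = L w}" unfolding fibres_def by blast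
  then have "x \<in> {v \<in> V. L v = L w}" "y \<in> {v \<in> V. L v = L w}" using Z(2) assms(3,4) by blast+
  then show "x \<in> V" "L x = L y" by simp_all
qed

lemma refines_fibres_same:
  assumes "refines V (fibres L V) M" "X \<in> M" "Y \<in> M" "x \<in> X" "y \<in> Y" "L x = L y"
  shows "X = Y"
proof (rule ccontr)
  assume "X \<noteq> Y"
  have part: "partition_on V M" using assms(1) by (simp add: refines_def)
  have xV: "x \<in> V" "y \<in> V" using partition_onD1[OF part] assms(2-5) by auto
  then have "{v \<in> V. L v = L x} \<in> fibres L V" unfolding fibres_def by blast
  then obtain W where W: "W \<in> M" "{v \<in> V. L v = L x} \<subseteq> W" using assms(1) unfolding refines_def by blast
  then have "x \<in> W" "y \<in> W" using xV assms(6) by auto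
  then have "W = X" "W = Y"
    using disjointD[OF partition_onD2[OF part]] W(1) assms(2-5) by blast+
  then show False using \<open>X \<noteq> Y\<close> by simp
qed

text \<open>One node of the tree, described without the tree: \<open>H\<close> is its red torso,
  \<open>A\<close> the adhesion set to its parent, \<open>S\<close> its children, \<open>J s\<close>
  the vertices strictly below child \<open>s\<close>, and \<open>Ad s\<close> the adhesion set of
  \<open>s\<close>. \<open>J_merges\<close> is the induction hypothesis. \<open>Ad_red\<close> is
  the place where the red colour of virtual edges enters. \<open>E_black\<close> trusts the torso
  off the red pairs only, since a virtual edge need not be an edge of the graph.\<close>

locale bag =
  fixes E :: "'a rel" and H :: "'a trigraph" and A :: "'a set"
    and S :: "'s set" and J :: "'s \<Rightarrow> 'a set" and Ad :: "'s \<Rightarrow> 'a set" and d D :: nat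
  assumes sym_E: "sym E"
    and wf: "wf_trigraph H"
    and tww_d: "tww H \<le> d"
    and D: "5 * d + 12 \<le> D" "18 \<le> D"
    and A: "A \<subseteq> tverts H" "card A \<le> 2"
    and finite_S: "finite S"
    and finite_J: "s \<in> S \<Longrightarrow> finite (J s)"
    and Ad: "s \<in> S \<Longrightarrow> Ad s \<subseteq> tverts H" "s \<in> S \<Longrightarrow> card (Ad s) \<le> 2"
    and J_tverts: "s \<in> S \<Longrightarrow> J s \<inter> tverts H = {}"
    and J_disjoint: "s \<in> S \<Longrightarrow> s' \<in> S \<Longrightarrow> s \<noteq> s' \<Longrightarrow> J s \<inter> J s' = {}"
    and J_edges: "s \<in> S \<Longrightarrow> w \<in> J s \<Longrightarrow> (w, v) \<in> E \<Longrightarrow> v \<in> J s \<union> Ad s"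
    and Ad_red: "s \<in> S \<Longrightarrow> u \<in> Ad s \<Longrightarrow> v \<in> Ad s \<Longrightarrow> u \<noteq> v \<Longrightarrow> (u, v) \<in> red H"
    and E_black: "u \<in> tverts H \<Longrightarrow> v \<in> tverts H \<Longrightarrow> u \<noteq> v \<Longrightarrow> (u, v) \<notin> red H \<Longrightarrow>
      (u, v) \<in> E \<longleftrightarrow> (u, v) \<in> black H"
    and J_merges: "s \<in> S \<Longrightarrow>
      ((\<lambda>v. {v}) ` J s, fibres (\<lambda>w. E `` {w} \<inter> Ad s) (J s)) \<in> (merge_step E D)\<^sup>*"
begin

section \<open>Labels of torso vertices and gadgets\<close>

definition K :: "'a set" where "K = tverts H - A"

definition I :: "'a set" where "I = K \<union> (\<Union>s\<in>S. J s)"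

text \<open>
  A vertex of a child is attached to the part of its adhesion set outside \<open>A\<close>; this makes torso
  vertices and gadgets carry labels of the same shape.
\<close>

definition anch :: "'a \<Rightarrow> 'a set" where
  "anch w = (if w \<in> K then {w} else {v \<in> K. \<exists>s\<in>S. w \<in> J s \<and> v \<in> Ad s})"

definition cl :: "'a \<Rightarrow> 'a set" where "cl w = E `` {w} \<inter> A"

text \<open>The Boolean keeps a torso vertex apart from a gadget hanging on that vertex alone; the
  two may agree in both other entries.\<close>

definition lab :: "('a \<Rightarrow> 'a) \<Rightarrow> 'a \<Rightarrow> bool \<times> 'a set \<times> 'a set" where
  "lab f w = (w \<in> K, f ` anch w, cl w)"

text \<open>
  The intermediate partition in which the gadgets already follow the later map \<open>g\<close> but the torso
  vertices still follow \<open>f\<close>.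
\<close>

definition lab2 :: "('a \<Rightarrow> 'a) \<Rightarrow> ('a \<Rightarrow> 'a) \<Rightarrow> 'a \<Rightarrow> bool \<times> 'a set \<times> 'a set" where
  "lab2 f g w = (if w \<in> K then lab f w else lab g w)"

definition nb :: "('a \<Rightarrow> 'a) \<Rightarrow> 'a \<Rightarrow> 'a set" where "nb f a = {b. (a, b) \<in> red (quot H f)}"

lemma finite_tverts: "finite (tverts H)" using wf by (simp add: wf_trigraph_def)

lemma finite_K: "finite K" using finite_tverts by (simp add: K_def)

lemma finite_A: "finite A" using A(1) finite_tverts by (rule finite_subset)

lemma finite_I: "finite I" using finite_K finite_S finite_J by (simp add: I_def)

lemma finite_Ad: "s \<in> S \<Longrightarrow> finite (Ad s)" using Ad(1) finite_tverts by (rule finite_subset)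

lemma card_Pow_A: "finite (Pow A)" "card (Pow A) \<le> 4"
proof -
  show "finite (Pow A)" using finite_A by simp
  have "card (Pow A) \<le> 2 ^ 2" unfolding card_Pow[OF finite_A] by (rule power_increasing[OF A(2)]) simp
  then show "card (Pow A) \<le> 4" by simp
qed

lemma card_Pow_Ad: "s \<in> S \<Longrightarrow> card (Pow (Ad s)) \<le> 4"
proof -
  assume s: "s \<in> S"
  have "card (Pow (Ad s)) \<le> 2 ^ 2"
    unfolding card_Pow[OF finite_Ad[OF s]] by (rule power_increasing[OF Ad(2)[OF s]]) simp
  then show ?thesis by simp
qed

lemma card_labels: "finite X \<Longrightarrow> card X \<le> n \<Longrightarrow> card ({b} \<times> X \<times> Pow A) \<le> 4 * n"
  using card_Pow_A mult_le_mono[of "card X" n "card (Pow A)" 4] by (simp add: card_cartesian_product mult.commute)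

section \<open>Anchors, traces and edges of the vertices below a child\<close>

lemma J_not_K: "s \<in> S \<Longrightarrow> w \<in> J s \<Longrightarrow> w \<notin> K" using J_tverts unfolding K_def by blast

lemma anch_J: "s \<in> S \<Longrightarrow> w \<in> J s \<Longrightarrow> anch w = Ad s - A"
  using J_not_K[of s w] J_disjoint[of s] Ad(1)[of s] unfolding anch_def K_def by auto

lemma anch_K: "w \<in> K \<Longrightarrow> anch w = {w}" by (simp add: anch_def)

lemma noncoreE:
  assumes "w \<in> I" "w \<notin> K" obtains s where "s \<in> S" "w \<in> J s"
  using assms unfolding I_def by blast

lemma anch_subset: "anch w \<subseteq> K" by (auto simp: anch_def)

lemma finite_anch: "finite (anch w)" using anch_subset finite_K by (rule finite_subset)

lemma card_anch: "w \<in> I \<Longrightarrow> card (anch w) \<le> 2"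
proof (cases "w \<in> K")
  case False
  assume "w \<in> I"
  then obtain s where s: "s \<in> S" "w \<in> J s" using False by (rule noncoreE)
  have "card (Ad s - A) \<le> card (Ad s)" using finite_Ad[OF s(1)] by (intro card_mono) auto
  then show ?thesis using anch_J[OF s] Ad(2)[OF s(1)] by simp
qed (simp add: anch_K)

lemma cl_subset: "cl w \<in> Pow A" by (auto simp: cl_def)

text \<open>Edges leaving \<open>J s\<close> end in \<open>Ad s\<close>, so the trace on
  \<open>A\<close> can be read off the trace on \<open>Ad s\<close>. This makes the labels of the
  bag coarser than the classes that the child was reduced to.\<close>

lemma cl_J: "s \<in> S \<Longrightarrow> w \<in> J s \<Longrightarrow> cl w = (E `` {w} \<inter> Ad s) \<inter> A"
  using J_edges[of s w] J_tverts[of s] A(1) unfolding cl_def by blast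

text \<open>Two ends outside \<open>A\<close> use up an adhesion set of size at most 2, so
  \<open>w\<close> has no way to reach \<open>A\<close>.\<close>

lemma anch_two:
  assumes "w \<in> I" "w \<notin> K" "u \<in> anch w" "v \<in> anch w" "u \<noteq> v"
  shows "(u, v) \<in> red H" "cl w = {}" "anch w = {u, v}"
proof -
  obtain s where s: "s \<in> S" "w \<in> J s" using assms(1,2) by (rule noncoreE)
  have uv: "u \<in> Ad s" "v \<in> Ad s" "u \<notin> A" "v \<notin> A" using assms(3,4) anch_J[OF s] by auto
  then show "(u, v) \<in> red H" using Ad_red s(1) assms(5) by blast
  have "{u, v} = Ad s"
    using uv Ad(2)[OF s(1)] assms(5) finite_Ad[OF s(1)] by (intro card_seteq) auto
  then have "Ad s \<inter> A = {}" "Ad s - A = {u, v}" using uv by auto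
  then show "cl w = {}" "anch w = {u, v}" using cl_J[OF s] anch_J[OF s] by auto
qed

lemma edge_core:
  assumes "v \<in> K" "w \<in> I" "w \<notin> K" "(v, w) \<in> E \<or> (w, v) \<in> E"
  shows "v \<in> anch w"
proof -
  obtain s where s: "s \<in> S" "w \<in> J s" using assms(2,3) by (rule noncoreE)
  have "v \<in> J s \<union> Ad s" using J_edges[OF s] assms(4) sym_E by (meson symD)
  then show ?thesis using assms(1) J_not_K[OF s(1)] anch_J[OF s] unfolding K_def by blast
qed

lemma edge_noncore:
  assumes "w \<in> I" "w \<notin> K" "w' \<notin> K" "w' \<in> I" "(w, w') \<in> E"
  obtains s where "s \<in> S" "w \<in> J s" "w' \<in> J s" "anch w' = anch w"
proof -
  obtain s where s: "s \<in> S" "w \<in> J s" using assms(1,2) by (rule noncoreE)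
  obtain s' where s': "s' \<in> S" "w' \<in> J s'" using assms(4,3) by (rule noncoreE)
  have "w' \<in> J s" using J_edges[OF s assms(5)] Ad(1)[OF s(1)] J_tverts[OF s'(1)] s'(2) by blast
  then show ?thesis using that s anch_J by metis
qed

section \<open>Red neighbours in the quotient torso and the degree counts\<close>

lemma nb_iff: "b \<in> nb f a \<longleftrightarrow> (a, b) \<in> red (quot H f)" by (simp add: nb_def)

lemma finite_nb: "finite (nb f a)"
  by (rule finite_subset[of _ "f ` tverts H"]) (auto simp: nb_def finite_tverts)

text \<open>Red and black are disjoint, so a red pair can never be part of an all-black pair of
  fibres: it stays red in every quotient that separates its ends.\<close>

lemma red_nb:
  assumes "(u, v) \<in> red H" "f u \<noteq> f v" shows "f v \<in> nb f (f u)"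
proof -
  have "u \<in> tverts H" "v \<in> tverts H" "(u, v) \<notin> black H"
    using wf assms(1) unfolding wf_trigraph_def by blast+
  moreover from this have "some_edge H f (f u) (f v)" "\<not> all_black H f (f u) (f v)"
    using assms(1) unfolding some_edge_def all_black_def by blast+
  ultimately show ?thesis using assms(2) by (simp add: nb_iff)
qed

text \<open>\<open>X\<close> and \<open>Y\<close> may be proper pieces of fibres, as parts are split
  by their traces. A red pair between them is enough by \<open>red_nb\<close>; without one,
  \<open>E\<close> and \<open>black H\<close> agree across, and mixedness shows up as one black and
  one non-black pair.\<close>

lemma core_mixed:
  assumes "mixed E X Y" "X \<subseteq> K" "Y \<subseteq> K" "\<And>x. x \<in> X \<Longrightarrow> f x = a" "\<And>y. y \<in> Y \<Longrightarrow> f y = b" "a \<noteq> b"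
  shows "b \<in> nb f a"
proof (cases "\<exists>x\<in>X. \<exists>y\<in>Y. (x, y) \<in> red H")
  case True
  then show ?thesis using red_nb assms(4-6) by metis
next
  case False
  obtain x y x' y' where xy: "x \<in> X" "y \<in> Y" "(x, y) \<in> E" "x' \<in> X" "y' \<in> Y" "(x', y') \<notin> E"
    using assms(1) unfolding mixed_def by blast
  have t: "x \<in> tverts H" "y \<in> tverts H" "x' \<in> tverts H" "y' \<in> tverts H"
    using xy assms(2,3) unfolding K_def by blast+
  have ne: "x \<noteq> y" "x' \<noteq> y'" using xy assms(4-6) by metis+
  have bl: "(x, y) \<in> black H" "(x', y') \<notin> black H" using False E_black t ne xy by blast+
  have "some_edge H f a b" "\<not> all_black H f a b"
    using bl t xy assms(4,5) unfolding some_edge_def all_black_def by blast+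
  moreover have "a \<in> f ` tverts H" "b \<in> f ` tverts H" using t xy assms(4,5) by blast+
  ultimately show ?thesis using assms(6) by (simp add: nb_iff)
qed

text \<open>A second end with another name costs a red neighbour but leaves a single possible trace.
  This is why two-ended gadgets contribute \<open>d\<close> to the count and not
  \<open>4d\<close>.\<close>

lemma anch_label:
  assumes "w \<in> I" "w \<notin> K" "a \<in> anch w"
  shows "f ` anch w = {f a} \<or> (\<exists>b\<in>nb f (f a). f ` anch w = {f a, b} \<and> cl w = {})"
proof (cases "\<exists>u\<in>anch w. f u \<noteq> f a")
  case True
  then obtain u where u: "u \<in> anch w" "f u \<noteq> f a" by blast
  then have "a \<noteq> u" by blast
  note two = anch_two[OF assms u(1) this]
  have "f u \<in> nb f (f a)" using red_nb[OF two(1) u(2)[symmetric]] .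
  moreover have "f ` anch w = {f a, f u}" unfolding two(3) by simp
  ultimately show ?thesis using two(2) by blast
next
  case False
  then have "f ` anch w \<subseteq> {f a}" by blast
  moreover have "f a \<in> f ` anch w" using assms(3) by (rule imageI)
  ultimately have "f ` anch w = {f a}" by blast
  then show ?thesis ..
qed

text \<open>Red neighbours are taken in the quotient by \<open>g\<close>, whereas torso parts are
  counted by their \<open>f\<close>-labels. The two maps differ only where \<open>f\<close> has the
  value \<open>z\<close>, the name that the current contraction removes.\<close>

lemma narrow_core:
  assumes M: "refines I (fibres (lab2 f g) I) M" and X: "X \<in> M" "X \<subseteq> K"
    and const: "\<And>Y y y'. Y \<in> M \<Longrightarrow> y \<in> Y \<Longrightarrow> y' \<in> Y \<Longrightarrow> y \<in> K \<Longrightarrow> y' \<in> K \<and> g y = g y'"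
    and fg: "\<And>v. f v = g v \<or> f v = z"
    and deg: "\<And>a. a \<in> g ` tverts H \<Longrightarrow> card (nb g a) \<le> d"
  shows "card {Y \<in> M. Y \<noteq> X \<and> mixed E X Y} \<le> 5 * d + 12"
proof -
  have part: "partition_on I M" using M by (simp add: refines_def)
  obtain x where x: "x \<in> X" using X(1) partition_onD3[OF part] by (metis ex_in_conv)
  define a where "a = g x"
  have gX: "g v = a" if "v \<in> X" for v using const[OF X(1) that x] X(2) that by (auto simp: a_def)
  have "a \<in> g ` tverts H" using x X(2) unfolding a_def K_def by blast
  then have nb: "card (nb g a) \<le> d" by (rule deg)
  let ?B = "insert z (insert a (nb g a))"
  \<comment> \<open>Torso parts with four traces for each of \<open>d + 2\<close> names, gadgets on
    \<open>a\<close> alone with four traces, and gadgets from \<open>a\<close> to a red neighbour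
    with the empty trace: \<open>4(d + 2) + 4 + d = 5d + 12\<close>.\<close>
  define T1 where "T1 = {True} \<times> (\<lambda>b. {b}) ` ?B \<times> Pow A"
  define T2 where "T2 = {False} \<times> {{a}} \<times> Pow A"
  define T3 where "T3 = {False} \<times> (\<lambda>b. {a, b}) ` nb g a \<times> {{} :: 'a set}"
  have "card ((\<lambda>b. {b}) ` ?B) \<le> d + 2"
    using card_image_le[of ?B "\<lambda>b. {b}"] card_insert_le_m1[of _ ?B] finite_nb nb
    by (simp add: card_insert_if split: if_splits)
  then have "card T1 \<le> 4 * (d + 2)" using finite_nb unfolding T1_def by (intro card_labels) auto
  moreover have "card T2 \<le> 4 * 1" unfolding T2_def by (intro card_labels) auto
  moreover have "card T3 \<le> d"
    using card_image_le[OF finite_nb, of "\<lambda>b. {a, b}" g a] nb by (simp add: T3_def card_cartesian_product)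
  ultimately have "card (T1 \<union> T2 \<union> T3) \<le> 5 * d + 12"
    using card_Un_le[of T1 T2] card_Un_le[of "T1 \<union> T2" T3] by simp
  moreover have "card {Y \<in> M. Y \<noteq> X \<and> mixed E X Y} \<le> card (T1 \<union> T2 \<union> T3)"
  proof (rule card_parts_le[OF M])
    show "finite (T1 \<union> T2 \<union> T3)" using finite_nb finite_A by (simp add: T1_def T2_def T3_def)
    fix Y assume Y: "Y \<in> {Y \<in> M. Y \<noteq> X \<and> mixed E X Y}"
    then have YM: "Y \<in> M" and mx: "mixed E X Y" by auto
    obtain u v where uv: "u \<in> X" "v \<in> Y" "(u, v) \<in> E" using mx unfolding mixed_def by blast
    have vI: "v \<in> I" using uv(2) YM partition_onD1[OF part] by blast
    have "lab2 f g v \<in> T1 \<union> T2 \<union> T3"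
    proof (cases "v \<in> K")
      case True
      have "g v = a \<or> g v \<in> nb g a"
        using core_mixed[OF mx X(2), of g a "g v"] const[OF YM uv(2)] gX True by (metis subsetI)
      then have "f v \<in> ?B" using fg[of v] by auto
      then have "(True, {f v}, cl v) \<in> T1" unfolding T1_def using cl_subset[of v] by blast
      moreover have "lab2 f g v = (True, {f v}, cl v)" using True by (simp add: lab2_def lab_def anch_K)
      ultimately show ?thesis by simp
    next
      case False
      have "u \<in> anch v" using edge_core uv X(2) vI False by blast
      from anch_label[OF vI False this, of g]
      have "(False, g ` anch v, cl v) \<in> T2 \<union> T3"
      proof
        assume "g ` anch v = {g u}"
        then show ?thesis unfolding T2_def gX[OF uv(1)] using cl_subset[of v] by blast
      next
        assume "\<exists>b\<in>nb g (g u). g ` anch v = {g u, b} \<and> cl v = {}"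
        then show ?thesis unfolding T3_def gX[OF uv(1)] by blast
      qed
      moreover have "lab2 f g v = (False, g ` anch v, cl v)" using False by (simp add: lab2_def lab_def)
      ultimately show ?thesis by simp
    qed
    then show "\<exists>y\<in>Y. lab2 f g y \<in> T1 \<union> T2 \<union> T3" using uv(2) by blast
  qed auto
  ultimately show ?thesis by linarith
qed

text \<open>\<open>B\<close> holds the names of the ends of the gadget under \<open>h\<close>, and
  \<open>z\<close> the one extra name that \<open>f\<close> may still use. \<open>T\<close> holds
  the anchor images of other gadget classes on the same anchors. For two different ends all of these
  have the empty trace and thus one label, so there \<open>T\<close> can be required to be
  empty.\<close>

lemma narrow_noncore:
  assumes M: "refines I (fibres (lab2 f g) I) M" and X: "X \<in> M" "X \<inter> K = {}"
    and const: "\<And>v. v \<in> X \<Longrightarrow> h ` anch v = B"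
    and fh: "\<And>v. f v = h v \<or> f v = z"
    and T: "finite T" "card T \<le> 2"
      "card B = 2 \<Longrightarrow> T = {}"
      "\<And>u v. u \<in> X \<Longrightarrow> v \<in> I \<Longrightarrow> v \<notin> K \<Longrightarrow> anch v = anch u \<Longrightarrow> lab2 f g u \<noteq> lab2 f g v \<Longrightarrow> g ` anch v \<in> T"
  shows "card {Y \<in> M. Y \<noteq> X \<and> mixed E X Y} \<le> 18"
proof -
  have part: "partition_on I M" using M by (simp add: refines_def)
  obtain x where x: "x \<in> X" using X(1) partition_onD3[OF part] by (metis ex_in_conv)
  have XI: "X \<subseteq> I" using X(1) partition_onD1[OF part] by blast
  have fin_B: "finite B" using const[OF x] finite_anch by blast
  have card_B: "card B \<le> 2"
    using order_trans[OF card_image_le[OF finite_anch, of h x] card_anch[OF subsetD[OF XI x]]]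
    unfolding const[OF x] .
  define T1 where "T1 = {True} \<times> (\<lambda>b. {b}) ` (insert z B) \<times> Pow A"
  define T2 where "T2 = {False} \<times> T \<times> Pow A"
  have B1: "card ((\<lambda>b. {b}) ` insert z B) \<le> Suc (card B)"
    using card_image_le[of "insert z B" "\<lambda>b. {b}"] fin_B by (simp add: card_insert_if split: if_splits)
  \<comment> \<open>At most one end gives \<open>4 * 2 + 4 * 2\<close>, two ends give
    \<open>4 * 3\<close>; so 16 is what the count yields, within the 18 of the theorem.\<close>
  have arith: "c \<le> 18" if "t1 \<le> 4 * Suc b" "t2 \<le> 4 * t" "c \<le> t1 + t2" "b \<le> 1 \<or> b = 2 \<and> t = 0" "t \<le> 2"
    for t1 t2 b t c :: nat using that by auto
  have t1: "card T1 \<le> 4 * Suc (card B)"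
    unfolding T1_def by (rule card_labels[OF _ B1]) (simp add: fin_B)
  have t2: "card T2 \<le> 4 * card T" unfolding T2_def by (rule card_labels[OF T(1) order_refl])
  have "card B \<le> 1 \<or> card B = 2" using card_B by linarith
  then have "card B \<le> 1 \<or> card B = 2 \<and> card T = 0" using T(3) by (elim disjE) simp_all
  from arith[OF t1 t2 card_Un_le this T(2)] have "card (T1 \<union> T2) \<le> 18" .
  moreover have "card {Y \<in> M. Y \<noteq> X \<and> mixed E X Y} \<le> card (T1 \<union> T2)"
  proof (rule card_parts_le[OF M])
    show "finite (T1 \<union> T2)" using fin_B T(1) finite_A by (simp add: T1_def T2_def)
    fix Y assume Y: "Y \<in> {Y \<in> M. Y \<noteq> X \<and> mixed E X Y}"
    then have YM: "Y \<in> M" and mx: "mixed E X Y" and ne: "Y \<noteq> X" by auto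
    obtain u v where uv: "u \<in> X" "v \<in> Y" "(u, v) \<in> E" using mx unfolding mixed_def by blast
    have vI: "v \<in> I" using uv(2) YM partition_onD1[OF part] by blast
    have uI: "u \<in> I" "u \<notin> K" using uv(1) X(2) XI by blast+
    have "lab2 f g v \<in> T1 \<union> T2"
    proof (cases "v \<in> K")
      case True
      then have "v \<in> anch u" using edge_core uv(3) uI by blast
      then have "h v \<in> B" using const[OF uv(1)] by blast
      then have "f v \<in> insert z B" using fh[of v] by auto
      then have "(True, {f v}, cl v) \<in> T1" unfolding T1_def using cl_subset[of v] by blast
      moreover have "lab2 f g v = (True, {f v}, cl v)" using True by (simp add: lab2_def lab_def anch_K)
      ultimately show ?thesis by simp
    next
      case False
      then have "anch v = anch u" using edge_noncore[OF uI False vI uv(3)] by blast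
      moreover have "lab2 f g u \<noteq> lab2 f g v"
        using refines_fibres_same[OF M X(1) YM uv(1,2)] ne by metis
      ultimately have "g ` anch v \<in> T" using T(4)[OF uv(1) vI False] by simp
      then have "(False, g ` anch v, cl v) \<in> T2" unfolding T2_def using cl_subset[of v] by blast
      moreover have "lab2 f g v = (False, g ` anch v, cl v)" using False by (simp add: lab2_def lab_def)
      ultimately show ?thesis by simp
    qed
    then show "\<exists>y\<in>Y. lab2 f g y \<in> T1 \<union> T2" using uv(2) by blast
  qed auto
  ultimately show ?thesis by linarith
qed

section \<open>Following one contraction of the torso\<close>

lemma lab2_same: "lab2 f f = lab f"
  by (rule ext) (simp add: lab2_def)

lemma lab2_core: "w \<in> K \<Longrightarrow> lab2 f g w = (True, {f w}, cl w)"
  by (simp add: lab2_def lab_def anch_K)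

lemma lab2_noncore: "w \<notin> K \<Longrightarrow> lab2 f g w = (False, g ` anch w, cl w)"
  by (simp add: lab2_def lab_def)

lemma lab2_eq_iff:
  "lab2 f g v = lab2 f g w \<longleftrightarrow>
     (v \<in> K \<longleftrightarrow> w \<in> K) \<and> (if v \<in> K then f v = f w else g ` anch v = g ` anch w) \<and> cl v = cl w"
  by (cases "v \<in> K"; cases "w \<in> K") (auto simp: lab2_core lab2_noncore)

lemma lab2_refinesD:
  assumes "refines I M (fibres (lab2 f g) I)" "X \<in> M" "x \<in> X" "y \<in> X"
  shows "x \<in> K \<longleftrightarrow> y \<in> K" "x \<in> K \<Longrightarrow> f x = f y" "x \<notin> K \<Longrightarrow> g ` anch x = g ` anch y"
proof -
  have *: "lab2 f g x = lab2 f g y" using refines_fibresD[OF assms] by simp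
  show "x \<in> K \<longleftrightarrow> y \<in> K" "x \<in> K \<Longrightarrow> f x = f y" "x \<notin> K \<Longrightarrow> g ` anch x = g ` anch y"
    using *[unfolded lab2_eq_iff] by simp_all
qed

lemma lab2_core_const:
  "refines I M (fibres (lab2 f g) I) \<Longrightarrow> X \<in> M \<Longrightarrow> x \<in> X \<Longrightarrow> y \<in> X \<Longrightarrow> x \<in> K \<Longrightarrow> y \<in> K \<and> f x = f y"
  using lab2_refinesD(1,2) by metis

lemma narrow_parts:
  assumes "refines I M (fibres (lab2 f g) I)"
    and "\<And>X. X \<in> M \<Longrightarrow> X \<subseteq> K \<Longrightarrow> card {Y \<in> M. Y \<noteq> X \<and> mixed E X Y} \<le> 5 * d + 12"
    and "\<And>X. X \<in> M \<Longrightarrow> X \<inter> K = {} \<Longrightarrow> card {Y \<in> M. Y \<noteq> X \<and> mixed E X Y} \<le> 18"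
  shows "narrow E D M"
proof (rule narrowI)
  fix X assume X: "X \<in> M"
  have "partition_on I M" using assms(1) by (simp add: refines_def)
  then obtain x where x: "x \<in> X" using X partition_onD3 by (metis ex_in_conv)
  show "card {Y \<in> M. Y \<noteq> X \<and> mixed E X Y} \<le> D"
  proof (cases "x \<in> K")
    case True
    then have "X \<subseteq> K" using lab2_refinesD(1)[OF assms(1) X x] by blast
    then show ?thesis using assms(2)[OF X] D(1) by linarith
  next
    case False
    then have "X \<inter> K = {}" using lab2_refinesD(1)[OF assms(1) X x] by blast
    then show ?thesis using assms(3)[OF X] D(2) by linarith
  qed
qed

text \<open>Gadgets move first, torso vertices second. Then each half is paid for by the degrees of
  a single quotient, that of \<open>f\<close> before and that of \<open>f'\<close> after. In the
  opposite order the merged torso part would face the separate gadgets of \<open>x\<close> and of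
  \<open>y\<close> at once.\<close>

lemma contraction_step_merges:
  assumes xy: "x \<noteq> y" and f': "f' = identify x y f"
    and deg: "\<And>a. a \<in> f ` tverts H \<Longrightarrow> card (nb f a) \<le> d" "\<And>a. a \<in> f' ` tverts H \<Longrightarrow> card (nb f' a) \<le> d"
  shows "(fibres (lab f) I, fibres (lab f') I) \<in> (merge_step E D)\<^sup>*"
proof -
  have ff': "f v = f' v \<or> f v = y" for v by (simp add: f' identify_def)
  have comp: "f' v = (if f v = y then x else f v)" for v by (simp add: f' identify_def)
  have img: "f' ` U = f' ` W" if "f ` U = f ` W" for U W
  proof -
    have "f' = (\<lambda>a. if a = y then x else a) \<circ> f" by (rule ext) (simp add: comp)
    then show ?thesis using that by (simp only: image_comp[symmetric])
  qed
  have r1: "refines I (fibres (lab2 f f) I) (fibres (lab2 f f') I)"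
    by (rule refines_fibres, unfold lab2_eq_iff) (metis img)
  have r2: "refines I (fibres (lab2 f f') I) (fibres (lab2 f' f') I)"
    by (rule refines_fibres, unfold lab2_eq_iff) (simp add: comp split: if_splits)
  have "narrow E D M" if M: "refines I (fibres (lab2 f f) I) M" "refines I M (fibres (lab2 f f') I)" for M
  proof (rule narrow_parts[OF M(2)])
    fix X assume X: "X \<in> M" "X \<subseteq> K"
    show "card {Y \<in> M. Y \<noteq> X \<and> mixed E X Y} \<le> 5 * d + 12"
      using narrow_core[OF M(1) X lab2_core_const[OF M(2)] disjI1[OF refl] deg(1)] .
  next
    fix X assume X: "X \<in> M" "X \<inter> K = {}"
    have "partition_on I M" using M(1) by (simp add: refines_def)
    then obtain u0 where u0: "u0 \<in> X" using X partition_onD3 by (metis ex_in_conv)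
    have XI: "X \<subseteq> I" using X(1) \<open>partition_on I M\<close> partition_onD1 by blast
    have const: "f' ` anch v = f' ` anch u0" if "v \<in> X" for v
      using lab2_refinesD(3)[OF M(2) X(1) that u0] X(2) that by blast
    define B where "B = f' ` anch u0"
    \<comment> \<open>The labels counted here still use \<open>f\<close>: a single anchor with
      \<open>f'\<close>-name \<open>b\<close> has \<open>f\<close>-name \<open>b\<close> or the
      vanishing name \<open>y\<close>.\<close>
    define T where "T = (if B = {} then {{}} else if card B = 1 then (\<lambda>b. {b}) ` insert y B else {})"
    have fin_B: "finite B" unfolding B_def using finite_anch by blast
    show "card {Y \<in> M. Y \<noteq> X \<and> mixed E X Y} \<le> 18"
    proof (rule narrow_noncore[OF M(1) X, where h = f' and B = B and z = y and T = T])
      show "f' ` anch v = B" if "v \<in> X" for v using const[OF that] by (simp add: B_def)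
      show "f v = f' v \<or> f v = y" for v by (rule ff')
      show "finite T" using fin_B by (simp add: T_def)
      have "card ((\<lambda>b. {b}) ` insert y B) \<le> Suc (card B)"
        using card_image_le[of "insert y B" "\<lambda>b. {b}"] fin_B by (simp add: card_insert_if split: if_splits)
      then show "card T \<le> 2" by (simp add: T_def)
      show "T = {}" if "card B = 2" using that by (auto simp: T_def)
      fix u v assume u: "u \<in> X" and v: "v \<in> I" "v \<notin> K" and an: "anch v = anch u"
        and ne: "lab2 f f u \<noteq> lab2 f f v"
      have uK: "u \<in> I" "u \<notin> K" using u X(2) XI by blast+
      \<comment> \<open>Two anchors would make both traces empty, and \<open>u\<close> and
        \<open>v\<close> would have equal labels.\<close>
      have single: "p = q" if "p \<in> anch v" "q \<in> anch v" for p q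
      proof (rule ccontr)
        assume "p \<noteq> q"
        then have "cl v = {}" "cl u = {}"
          using anch_two(2)[OF v that] anch_two(2)[OF uK, of p q] that an by auto
        then show False using ne an v(2) uK(2) by (simp add: lab2_noncore)
      qed
      have BB: "B = f' ` anch v" using const[OF u] an by (simp add: B_def)
      show "f ` anch v \<in> T"
      proof (cases "anch v = {}")
        case True
        then show ?thesis using BB by (simp add: T_def)
      next
        case False
        then obtain p where "p \<in> anch v" by blast
        then have p: "anch v = {p}" using single by blast
        then have "B = {f' p}" using BB by simp
        then show ?thesis using p ff'[of p] by (auto simp: T_def)
      qed
    qed
  qed
  from coarsening_merges[OF finite_I r1 this]
  have 1: "(fibres (lab2 f f) I, fibres (lab2 f f') I) \<in> (merge_step E D)\<^sup>*" .
  have "narrow E D M" if M: "refines I (fibres (lab2 f f') I) M" "refines I M (fibres (lab2 f' f') I)" for M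
  proof (rule narrow_parts[OF M(2)])
    fix X assume X: "X \<in> M" "X \<subseteq> K"
    show "card {Y \<in> M. Y \<noteq> X \<and> mixed E X Y} \<le> 5 * d + 12"
      using narrow_core[OF M(1) X lab2_core_const[OF M(2)] ff' deg(2)] .
  next
    fix X assume X: "X \<in> M" "X \<inter> K = {}"
    have "partition_on I M" using M(1) by (simp add: refines_def)
    then obtain u0 where u0: "u0 \<in> X" using X partition_onD3 by (metis ex_in_conv)
    have const: "f' ` anch v = f' ` anch u0" if "v \<in> X" for v
      using lab2_refinesD(3)[OF M(2) X(1) that u0] X(2) that by blast
    define B where "B = f' ` anch u0"
    have XI: "X \<subseteq> I" using X(1) \<open>partition_on I M\<close> partition_onD1 by blast
    have fin_B: "finite B" unfolding B_def using finite_anch by blast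
    \<comment> \<open>Gadgets already carry their \<open>f'\<close>-names in this half, so
      \<open>B\<close> is the only anchor image left.\<close>
    define T where "T = (if card B = 2 then {} else {B})"
    show "card {Y \<in> M. Y \<noteq> X \<and> mixed E X Y} \<le> 18"
    proof (rule narrow_noncore[OF M(1) X, where h = f' and B = B and z = y and T = T])
      show "f' ` anch v = B" if "v \<in> X" for v using const[OF that] by (simp add: B_def)
      show "f v = f' v \<or> f v = y" for v by (rule ff')
      show "finite T" "card T \<le> 2" by (simp_all add: T_def)
      show "T = {}" if "card B = 2" using that by (simp add: T_def)
      fix u v assume u: "u \<in> X" and v: "v \<in> I" "v \<notin> K" and an: "anch v = anch u"
        and ne: "lab2 f f' u \<noteq> lab2 f f' v"
      have uK: "u \<in> I" "u \<notin> K" using u X(2) XI by blast+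
      have BB: "B = f' ` anch v" using const[OF u] an by (simp add: B_def)
      have "card B \<noteq> 2"
      proof
        assume "card B = 2"
        then obtain b c where "b \<in> B" "c \<in> B" "b \<noteq> c" by (auto simp: card_2_iff)
        then obtain p q where pq: "p \<in> anch v" "q \<in> anch v" "p \<noteq> q" unfolding BB by blast
        then have "cl v = {}" "cl u = {}"
          using anch_two(2)[OF v] anch_two(2)[OF uK, of p q] an by auto
        then show False using ne an v(2) uK(2) by (simp add: lab2_noncore)
      qed
      then show "f' ` anch v \<in> T" using BB by (simp add: T_def)
    qed
  qed
  from coarsening_merges[OF finite_I r2 this]
  have 2: "(fibres (lab2 f f') I, fibres (lab2 f' f') I) \<in> (merge_step E D)\<^sup>*" .
  from 1 2 show ?thesis unfolding lab2_same by (rule rtrancl_trans)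
qed

text \<open>With a single name left there are only 16 labels: two flags, two anchor images, four
  traces. So no partition in question has more than 16 parts. The anchor image is empty for children
  whose adhesion set lies in \<open>A\<close>.\<close>

lemma final_merges:
  assumes "f ` tverts H = {z}"
  shows "(fibres (lab f) I, fibres cl I) \<in> (merge_step E D)\<^sup>*"
proof (rule coarsening_merges[OF finite_I])
  show "refines I (fibres (lab f) I) (fibres cl I)"
    by (rule refines_fibres) (simp add: lab_def)
  fix M assume M: "refines I (fibres (lab f) I) M"
  have part: "partition_on I M" using M by (simp add: refines_def)
  define T where "T = {True} \<times> {{}, {z}} \<times> Pow A \<union> {False} \<times> {{}, {z}} \<times> Pow A"
  have lab: "card ({b} \<times> {{}, {z}} \<times> Pow A) \<le> 4 * 2" for b :: bool
    by (rule card_labels) (simp_all add: card_insert_if)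
  have "card T \<le> 4 * 2 + 4 * 2"
    unfolding T_def by (rule order_trans[OF card_Un_le add_mono[OF lab lab]])
  then have T16: "card T \<le> 16" by simp
  have fin: "finite T" using finite_A by (simp add: T_def)
  have T_lab: "lab f w \<in> T" for w
  proof -
    have "f ` anch w \<subseteq> {z}" using assms anch_subset[of w] unfolding K_def by blast
    then have "f ` anch w \<in> {{}, {z}}" by (simp add: subset_singleton_iff)
    then show ?thesis using cl_subset[of w] unfolding T_def lab_def by (cases "w \<in> K") simp_all
  qed
  have le: "card R \<le> 16" if "R \<subseteq> M" for R
  proof -
    have "card R \<le> card T"
    proof (rule card_parts_le[OF M that fin])
      fix Y assume "Y \<in> R"
      then have "Y \<noteq> {}" using that partition_onD3[OF part] by (rule_tac notI) auto
      then obtain y where "y \<in> Y" by blast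
      then show "\<exists>y\<in>Y. lab f y \<in> T" using T_lab by (rule_tac bexI)
    qed
    then show ?thesis using T16 by linarith
  qed
  show "narrow E D M"
  proof (rule narrowI)
    fix X
    have "card {Y \<in> M. Y \<noteq> X \<and> mixed E X Y} \<le> 16" by (rule le) auto
    then show "card {Y \<in> M. Y \<noteq> X \<and> mixed E X Y} \<le> D" using D(2) by linarith
  qed
qed

section \<open>Bringing in the children one at a time, before the torso moves\<close>

definition processed :: "'s set \<Rightarrow> 'a set" where "processed C = (\<Union>s\<in>C. J s)"

text \<open>The identity serves as name map since no torso vertex has been merged yet; everything
  outside the processed children is still a singleton.\<close>

definition stage :: "'s set \<Rightarrow> 'a \<Rightarrow> (bool \<times> 'a set \<times> 'a set) + 'a" where
  "stage C w = (if w \<in> processed C then Inl (lab id w) else Inr w)"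

text \<open>The moment when child \<open>s\<close> has just run its own merges. Its classes are
  traces on \<open>Ad s\<close>, not yet labels of this bag, and the middle summand keeps them apart
  from the children already relabelled.\<close>

definition half_stage :: "'s set \<Rightarrow> 's \<Rightarrow> 'a \<Rightarrow> (bool \<times> 'a set \<times> 'a set) + 'a set + 'a" where
  "half_stage C s w = (if w \<in> processed C then Inl (lab id w)
     else if w \<in> J s then Inr (Inl (E `` {w} \<inter> Ad s)) else Inr (Inr w))"

lemma processedD: "C \<subseteq> S \<Longrightarrow> w \<in> processed C \<Longrightarrow> w \<in> I \<and> w \<notin> K"
  using J_not_K unfolding processed_def I_def by blast

lemma processed_insert: "processed (insert s C) = J s \<union> processed C"
  by (auto simp: processed_def)

text \<open>On \<open>J s\<close> the anchor is constant and the trace on \<open>A\<close> is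
  determined by the trace on \<open>Ad s\<close>; relabelling only forgets adjacency to
  \<open>K\<close> and joins gadgets of different children on the same anchors.\<close>

lemma half_stage_refines:
  assumes "C \<subseteq> S" "s \<in> S"
  shows "refines I (fibres (half_stage C s) I) (fibres (stage (insert s C)) I)"
proof (rule refines_fibres)
  fix v w assume eq: "half_stage C s v = half_stage C s w"
  consider "v \<in> processed C" "w \<in> processed C" | "v \<notin> processed C" "w \<notin> processed C" "v \<in> J s" "w \<in> J s"
    | "v \<notin> processed C" "w \<notin> processed C" "v \<notin> J s" "w \<notin> J s"
    using eq by (fastforce simp: half_stage_def split: if_splits)
  then show "stage (insert s C) v = stage (insert s C) w"
  proof cases
    case 1
    then show ?thesis using eq by (simp add: half_stage_def stage_def processed_insert)
  next
    case 2
    then have "E `` {v} \<inter> Ad s = E `` {w} \<inter> Ad s" using eq by (simp add: half_stage_def)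
    then have "cl v = cl w" using 2 cl_J[OF assms(2)] by simp
    then have "lab id v = lab id w"
      using 2 anch_J[OF assms(2)] J_not_K[OF assms(2)] by (simp add: lab_def)
    then show ?thesis using 2 by (simp add: stage_def processed_insert)
  next
    case 3
    then show ?thesis using eq by (simp add: half_stage_def stage_def processed_insert)
  qed
qed

text \<open>Singletons are never mixed with each other. So a torso vertex sees at most
  \<open>4 + d\<close> classes of processed children and 4 classes of \<open>s\<close>, and a class
  of processed vertices sees at most 4 classes with its anchors, its 2 ends and 4 classes of
  \<open>s\<close>.\<close>

lemma narrow_half_stage:
  assumes C: "C \<subseteq> S" and s: "s \<in> S"
    and deg: "\<And>a. a \<in> tverts H \<Longrightarrow> card (nb id a) \<le> d"
    and M: "refines I (fibres (half_stage C s) I) M" "refines I M (fibres (stage (insert s C)) I)"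
  shows "narrow E D M"
proof (rule narrowI)
  fix X assume X: "X \<in> M"
  have part: "partition_on I M" using M(1) by (simp add: refines_def)
  then obtain x where x: "x \<in> X" using X partition_onD3 by (metis ex_in_conv)
  have xI: "x \<in> I" using x X partition_onD1[OF part] by blast
  have CS: "insert s C \<subseteq> S" using C s by simp
  have single: "Z = {z}" if "Z \<in> M" "z \<in> Z" "z \<notin> processed (insert s C)" for Z z
  proof -
    have "w = z" if "w \<in> Z" for w
      using refines_fibresD(2)[OF M(2) \<open>Z \<in> M\<close> that \<open>z \<in> Z\<close>] \<open>z \<notin> processed (insert s C)\<close>
      by (auto simp: stage_def split: if_splits)
    then show ?thesis using that(2) by blast
  qed
  have cases: "w \<in> processed C \<or> w \<in> J s \<and> half_stage C s w = Inr (Inl (E `` {w} \<inter> Ad s))"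
    if "w \<in> processed (insert s C)" for w
    using that unfolding processed_insert by (auto simp: half_stage_def)
  define U where "U = (\<lambda>c. Inr (Inl c) :: (bool \<times> 'a set \<times> 'a set) + 'a set + 'a) ` Pow (Ad s)"
  have U: "card U \<le> 4" "finite U"
    using order_trans[OF card_image_le card_Pow_Ad[OF s]] finite_Ad[OF s] unfolding U_def by simp_all
  have inU: "half_stage C s w \<in> U" if "half_stage C s w = Inr (Inl (E `` {w} \<inter> Ad s))" for w
    unfolding that U_def by blast
  show "card {Y \<in> M. Y \<noteq> X \<and> mixed E X Y} \<le> D"
  proof (cases "x \<in> processed (insert s C)")
    case False
    then have Xx: "X = {x}" using single X x by blast
    define T1 where "T1 = {False} \<times> {{x}} \<times> Pow A"
    define T2 where "T2 = {False} \<times> (\<lambda>b. {x, b}) ` nb id x \<times> {{} :: 'a set}"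
    \<comment> \<open>A part mixed with the singleton \<open>X\<close> cannot be a singleton, so it
      lies in processed children; an edge from there to the unprocessed \<open>x\<close> forces
      \<open>x\<close> into an adhesion set.\<close>
    have edge: "x \<in> K \<and> w \<in> processed (insert s C) \<and> (x, w) \<in> E" if Y: "Y \<in> M" "mixed E X Y" "w \<in> Y" "(x, w) \<in> E" for Y w
    proof -
      have w: "w \<in> processed (insert s C)"
        using single[OF Y(1,3)] Y(2) not_mixed_singletons[of E x w] unfolding Xx by metis
      then obtain s' where s': "s' \<in> insert s C" "w \<in> J s'" unfolding processed_def by blast
      have "x \<in> J s' \<union> Ad s'" using J_edges[of s' w x] s' CS Y(4) sym_E by (meson subsetD symD)
      moreover have "x \<notin> J s'" using False s'(1) unfolding processed_def by blast
      ultimately have "x \<in> Ad s'" by blast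
      then have "x \<in> tverts H" using Ad(1)[of s'] s'(1) CS by blast
      moreover have "x \<notin> J s''" if "s'' \<in> S" for s'' using J_tverts[OF that] \<open>x \<in> tverts H\<close> by blast
      ultimately have "x \<in> K" using xI unfolding I_def by blast
      then show ?thesis using w Y(4) by blast
    qed
    show ?thesis
    proof (cases "x \<in> K")
      case True
      then have "card (nb id x) \<le> d" using deg by (simp add: K_def)
      then have "card T2 \<le> d"
        using card_image_le[OF finite_nb, of "\<lambda>b. {x, b}" id x] by (simp add: T2_def card_cartesian_product)
      moreover have "card T1 \<le> 4 * 1" unfolding T1_def by (rule card_labels) simp_all
      moreover have fin: "finite T1" "finite T2" using finite_A finite_nb by (simp_all add: T1_def T2_def)
      have "card (Inl ` T1 \<union> Inl ` T2 \<union> U) \<le> card T1 + card T2 + card U"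
        by (intro order_trans[OF card_Un_le] add_mono card_image_le fin order_refl)
      ultimately have "card (Inl ` T1 \<union> Inl ` T2 \<union> U) \<le> d + 8" using U(1) by linarith
      moreover have "card {Y \<in> M. Y \<noteq> X \<and> mixed E X Y} \<le> card (Inl ` T1 \<union> Inl ` T2 \<union> U)"
      proof (rule card_parts_le[OF M(1)])
        show "finite (Inl ` T1 \<union> Inl ` T2 \<union> U)" using fin U(2) by simp
        fix Y assume Y: "Y \<in> {Y \<in> M. Y \<noteq> X \<and> mixed E X Y}"
        then obtain w where w: "w \<in> Y" "(x, w) \<in> E" unfolding mixed_def Xx by blast
        have wp: "w \<in> processed (insert s C)" using edge w Y by blast
        note wIK = processedD[OF CS wp]
        have anc: "x \<in> anch w" using edge_core[OF True] wIK w(2) by blast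
        have "half_stage C s w \<in> Inl ` T1 \<union> Inl ` T2 \<union> U"
          using cases[OF wp]
        proof
          assume wC: "w \<in> processed C"
          have "lab id w \<in> T1 \<union> T2"
            using anch_label[OF conjunct1[OF wIK] conjunct2[OF wIK] anc, of id]
          proof
            assume "id ` anch w = {id x}"
            then have "lab id w = (False, {x}, cl w)" using wIK by (simp add: lab_def)
            moreover have "(False, {x}, cl w) \<in> T1" unfolding T1_def using cl_subset[of w] by blast
            ultimately show ?thesis by simp
          next
            assume "\<exists>b\<in>nb id (id x). id ` anch w = {id x, b} \<and> cl w = {}"
            then obtain b where "b \<in> nb id (id x)" "id ` anch w = {id x, b}" "cl w = {}" by blast
            then have "lab id w = (False, {x, b}, {})" "b \<in> nb id x" using wIK by (simp_all add: lab_def)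
            moreover from this(2) have "(False, {x, b}, {}) \<in> T2" unfolding T2_def by blast
            ultimately show ?thesis by simp
          qed
          then show ?thesis using wC by (auto simp: half_stage_def)
        qed (use inU in blast)
        then show "\<exists>y\<in>Y. half_stage C s y \<in> Inl ` T1 \<union> Inl ` T2 \<union> U" using w(1) by blast
      qed auto
      ultimately show ?thesis using D(1) by linarith
    next
      case False
      have "{Y \<in> M. Y \<noteq> X \<and> mixed E X Y} = {}"
        using edge False unfolding mixed_def Xx by blast
      then show ?thesis by (simp only: card.empty)
    qed
  next
    case True
    note xIK = processedD[OF CS True]
    have const: "u \<in> processed (insert s C) \<and> anch u = anch x" if "u \<in> X" for u
      using refines_fibresD(2)[OF M(2) X that x] True by (auto simp: stage_def lab_def split: if_splits)
    define T1 where "T1 = {False} \<times> {anch x} \<times> Pow A"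
    define T2 where "T2 = (\<lambda>c. Inr (Inr c) :: (bool \<times> 'a set \<times> 'a set) + 'a set + 'a) ` anch x"
    have "card T2 \<le> 2"
      using order_trans[OF card_image_le[OF finite_anch] card_anch[OF xI]] unfolding T2_def .
    moreover have "card T1 \<le> 4 * 1" unfolding T1_def by (rule card_labels) simp_all
    moreover have fin: "finite T1" "finite T2" using finite_A finite_anch by (simp_all add: T1_def T2_def)
    have "card (Inl ` T1 \<union> T2 \<union> U) \<le> card T1 + card T2 + card U"
      by (intro order_trans[OF card_Un_le] add_mono card_image_le fin order_refl)
    ultimately have "card (Inl ` T1 \<union> T2 \<union> U) \<le> 10" using U(1) by linarith
    moreover have "card {Y \<in> M. Y \<noteq> X \<and> mixed E X Y} \<le> card (Inl ` T1 \<union> T2 \<union> U)"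
    proof (rule card_parts_le[OF M(1)])
      show "finite (Inl ` T1 \<union> T2 \<union> U)" using fin U(2) by simp
      fix Y assume Y: "Y \<in> {Y \<in> M. Y \<noteq> X \<and> mixed E X Y}"
      then obtain u w where w: "u \<in> X" "w \<in> Y" "(u, w) \<in> E" unfolding mixed_def by blast
      have wI: "w \<in> I" using Y w(2) partition_onD1[OF part] by blast
      have u: "u \<in> processed (insert s C)" "anch u = anch x" using const[OF w(1)] by auto
      note uIK = processedD[OF CS u(1)]
      have "half_stage C s w \<in> Inl ` T1 \<union> T2 \<union> U"
      proof (cases "w \<in> K")
        case True
        then have "w \<in> anch x" using edge_core[OF True, of u] uIK w(3) u(2) by blast
        moreover have "half_stage C s w = Inr (Inr w)"
          using True processedD[OF CS, of w] unfolding processed_insert by (auto simp: half_stage_def)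
        ultimately show ?thesis unfolding T2_def by blast
      next
        case False
        obtain s' where s': "s' \<in> S" "u \<in> J s'" "w \<in> J s'" "anch w = anch u"
          using edge_noncore[of u w] uIK wI False w(3) by metis
        obtain s'' where s'': "s'' \<in> insert s C" "u \<in> J s''" using u(1) unfolding processed_def by blast
        have "s'' = s'" using J_disjoint[of s' s''] s' s'' CS by blast
        then have wp: "w \<in> processed (insert s C)" using s'(3) s''(1) unfolding processed_def by blast
        show ?thesis using cases[OF wp]
        proof
          assume wC: "w \<in> processed C"
          have "lab id w = (False, anch x, cl w)" using False s'(4) u(2) by (simp add: lab_def)
          moreover have "(False, anch x, cl w) \<in> T1" unfolding T1_def using cl_subset[of w] by blast
          ultimately have "lab id w \<in> T1" by simp
          then show ?thesis using wC by (simp add: half_stage_def)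
        qed (use inU in blast)
      qed
      then show "\<exists>y\<in>Y. half_stage C s y \<in> Inl ` T1 \<union> T2 \<union> U" using w(2) by blast
    qed auto
    ultimately show ?thesis using D(2) by linarith
  qed
qed

lemma stage_merges:
  assumes deg: "\<And>a. a \<in> tverts H \<Longrightarrow> card (nb id a) \<le> d"
    and "C \<subseteq> S"
  shows "((\<lambda>v. {v}) ` I, fibres (stage C) I) \<in> (merge_step E D)\<^sup>* \<and> narrow E D (fibres (stage C) I)"
proof -
  have "finite C" using assms(2) finite_S by (rule finite_subset)
  then show ?thesis using assms(2)
  proof (induction rule: finite_induct)
    case empty
    have "fibres (stage {}) I = (\<lambda>v. {v}) ` I"
      by (rule fibres_inj) (simp add: inj_on_def stage_def processed_def)
    then show ?case using narrow_singletons by simp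
  next
    case (insert s C)
    then have s: "s \<in> S" "s \<notin> C" and C: "C \<subseteq> S" by auto
    have JI: "J s \<subseteq> I" using s(1) by (auto simp: I_def)
    have np: "w \<notin> processed C" if "w \<in> J s" for w
      using that J_disjoint[OF s(1)] s(2) C unfolding processed_def by blast
    define R where "R = fibres (stage C) (I - J s)"
    have disj: "stage C ` J s \<inter> stage C ` (I - J s) = {}"
      using np by (auto simp: stage_def split: if_splits)
    have "fibres (stage C) (J s \<union> (I - J s)) = fibres (stage C) (J s) \<union> R"
      unfolding R_def by (rule fibres_Un[OF disj])
    moreover have "fibres (stage C) (J s) = (\<lambda>v. {v}) ` J s"
      by (rule fibres_inj) (simp add: inj_on_def stage_def np)
    ultimately have pre: "fibres (stage C) I = (\<lambda>v. {v}) ` J s \<union> R"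
      using JI by (simp add: Un_absorb1)
    let ?Q = "fibres (\<lambda>w. E `` {w} \<inter> Ad s) (J s)"
    have half: "fibres (half_stage C s) I = ?Q \<union> R"
    proof -
      have "half_stage C s ` J s \<inter> half_stage C s ` (I - J s) = {}"
        using np by (auto simp: half_stage_def split: if_splits)
      from fibres_Un[OF this] have "fibres (half_stage C s) I = fibres (half_stage C s) (J s) \<union> fibres (half_stage C s) (I - J s)"
        using JI by (simp add: Un_absorb1)
      moreover have "fibres (half_stage C s) (J s) = ?Q"
        by (rule fibres_cong) (simp add: half_stage_def np)
      moreover have "fibres (half_stage C s) (I - J s) = R"
        unfolding R_def by (rule fibres_cong) (auto simp: half_stage_def stage_def)
      ultimately show ?thesis by simp
    qed
    have IH: "((\<lambda>v. {v}) ` I, fibres (stage C) I) \<in> (merge_step E D)\<^sup>*" "narrow E D (fibres (stage C) I)"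
      using insert.IH C by auto
    have fin: "finite (fibres (stage C) I)" using finite_I by (simp add: fibres_def)
    have nR: "narrow E D R" using narrow_subset[OF IH(2) _ fin] pre by blast
    have XI: "X \<subseteq> I - J s" if "X \<in> R" for X using that by (auto simp: R_def fibres_def)
    \<comment> \<open>An edge from \<open>J s\<close> to a frozen part ends in \<open>Ad s\<close>.
      That part is then a single torso vertex, and all of \<open>Z\<close> agrees about it because
      \<open>Z\<close> is a class of equal traces on \<open>Ad s\<close>.\<close>
    have nm: "\<not> mixed E Z X" if X: "X \<in> R" and Z: "Z \<in> ?Q" for X Z
    proof
      assume mx: "mixed E Z X"
      obtain z0 where Z0: "Z = {v \<in> J s. E `` {v} \<inter> Ad s = E `` {z0} \<inter> Ad s}"
        using Z unfolding fibres_def by blast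
      obtain z x where zx: "z \<in> Z" "x \<in> X" "(z, x) \<in> E" using mx unfolding mixed_def by blast
      have zJ: "z \<in> J s" using zx(1) unfolding Z0 by blast
      have xJ: "x \<in> I" "x \<notin> J s" using XI[OF X] zx(2) by auto
      have xA: "x \<in> Ad s" using J_edges[OF s(1) zJ zx(3)] xJ(2) by blast
      have "x \<notin> processed C"
        using Ad(1)[OF s(1)] xA J_tverts C unfolding processed_def by blast
      then have Xx: "X = {x}"
        using X zx(2) unfolding R_def fibres_def by (auto simp: stage_def split: if_splits)
      have "(z', x) \<in> E" if "z' \<in> Z" for z'
      proof -
        have "E `` {z'} \<inter> Ad s = E `` {z} \<inter> Ad s" using that zx(1) unfolding Z0 by auto
        then show ?thesis using zx(3) xA by blast
      qed
      then show False using mx unfolding mixed_def Xx by blast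
    qed
    have "((\<lambda>v. {v}) ` J s \<union> R, ?Q \<union> R) \<in> (merge_step E D)\<^sup>*"
      by (rule merges_frame[OF J_merges[OF s(1)] partition_on_singletons sym_E nR nm]) (use XI in blast)+
    moreover have "(?Q \<union> R, fibres (stage (insert s C)) I) \<in> (merge_step E D)\<^sup>*"
      unfolding half[symmetric]
      using coarsening_merges[OF finite_I half_stage_refines[OF C s(1)] narrow_half_stage[OF C s(1) deg]] .
    ultimately have "((\<lambda>v. {v}) ` I, fibres (stage (insert s C)) I) \<in> (merge_step E D)\<^sup>*"
      using IH(1) unfolding pre by (meson rtrancl_trans)
    moreover have "narrow E D (fibres (stage (insert s C)) I)"
      using narrow_half_stage[OF C s(1) deg half_stage_refines[OF C s(1)] refines_refl[OF partition_on_fibres]] .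
    ultimately show ?case ..
  qed
qed

lemma bag_merges: "((\<lambda>v. {v}) ` I, fibres cl I) \<in> (merge_step E D)\<^sup>*"
proof -
  obtain Hs where Hs: "contraction_sequence H Hs" "sequence_width Hs = tww H"
    using tww_attained[OF wf] .
  have width: "card (nb f a) \<le> d" if "quot H f \<in> set Hs" "a \<in> f ` tverts H" for f a
  proof -
    have "sequence_width Hs \<le> d" using Hs(2) tww_d by simp
    then have "red_degree (quot H f) a \<le> d"
      using sequence_width_le_iff[OF Hs(1) wf] that by fastforce
    then show ?thesis by (simp add: red_degree_def nb_def)
  qed
  have "Hs \<noteq> []" "hd Hs = H" using Hs(1) by (auto simp: contraction_sequence_def)
  then have "quot H id \<in> set Hs" using hd_in_set quot_id[OF wf] by metis
  then have deg: "card (nb id a) \<le> d" if "a \<in> tverts H" for a using width[of id a] that by simp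
  have "\<forall>H'\<in>set Hs. \<exists>f. H' = quot H f \<and> ((\<lambda>v. {v}) ` I, fibres (lab f) I) \<in> (merge_step E D)\<^sup>*"
    using Hs(1) wf
  proof (induction rule: contraction_sequence_induct)
    case id
    \<comment> \<open>Once all children are processed, only torso vertices are singletons, and under
      \<open>id\<close> their labels separate them as well.\<close>
    have "fibres (stage S) I = fibres (lab id) I"
    proof (rule fibres_cong)
      fix v w assume vw: "v \<in> I" "w \<in> I"
      have p: "u \<in> processed S \<longleftrightarrow> u \<notin> K" if "u \<in> I" for u
        using that J_not_K unfolding processed_def I_def by blast
      show "stage S v = stage S w \<longleftrightarrow> lab id v = lab id w"
        by (cases "v \<in> K"; cases "w \<in> K") (auto simp: stage_def p[OF vw(1)] p[OF vw(2)] lab_def anch_K)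
    qed
    then show ?case using stage_merges[OF deg order_refl] by simp
  next
    case (identify f x y)
    have "(fibres (lab f) I, fibres (lab (identify x y f)) I) \<in> (merge_step E D)\<^sup>*"
      using contraction_step_merges[OF identify(4) refl width[OF identify(5)] width[OF identify(6)]] .
    then show ?case using identify(1) by (rule rtrancl_trans[rotated])
  qed
  then obtain f where f: "last Hs = quot H f" "((\<lambda>v. {v}) ` I, fibres (lab f) I) \<in> (merge_step E D)\<^sup>*"
    using \<open>Hs \<noteq> []\<close> last_in_set by blast
  have "card (f ` tverts H) = 1" using Hs(1) f(1) by (simp add: contraction_sequence_def)
  then obtain z where "f ` tverts H = {z}" by (rule card_1_singletonE)
  from rtrancl_trans[OF f(2) final_merges[OF this]] show ?thesis .
qed

end

section \<open>Rooted tree decompositions\<close>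

text \<open>The tree is encoded by a parent map along which \<open>dep\<close> strictly decreases,
  with arcs only between a node and its parent. The trigraphs \<open>H t\<close> are abstract,
  subject to the two facts about red torsos that \<open>bag\<close> requires.\<close>

locale rooted_decomposition =
  fixes N :: "'t set" and arcs :: "'t rel" and r :: 't and par :: "'t \<Rightarrow> 't" and dep :: "'t \<Rightarrow> nat"
    and V :: "'a set" and E :: "'a rel" and B :: "'t \<Rightarrow> 'a set"
    and H :: "'t \<Rightarrow> 'a trigraph" and d D :: nat
  assumes finite_N: "finite N" and r: "r \<in> N"
    and par: "t \<in> N \<Longrightarrow> t \<noteq> r \<Longrightarrow> par t \<in> N" "t \<in> N \<Longrightarrow> t \<noteq> r \<Longrightarrow> dep (par t) < dep t"
      "t \<in> N \<Longrightarrow> t \<noteq> r \<Longrightarrow> (t, par t) \<in> arcs" "t \<in> N \<Longrightarrow> t \<noteq> r \<Longrightarrow> (par t, t) \<in> arcs"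
    and arcs: "(a, b) \<in> arcs \<Longrightarrow> a \<in> N \<and> b \<in> N \<and> (a \<noteq> r \<and> b = par a \<or> b \<noteq> r \<and> a = par b)"
    and finite_V: "finite V" and V: "V \<noteq> {}"
    and sym_E: "sym E" and E: "(u, v) \<in> E \<Longrightarrow> \<exists>t\<in>N. u \<in> B t \<and> v \<in> B t"
    and bags: "t \<in> N \<Longrightarrow> B t \<subseteq> V" "v \<in> V \<Longrightarrow> \<exists>t\<in>N. v \<in> B t"
    and conn: "v \<in> V \<Longrightarrow> s \<in> N \<Longrightarrow> v \<in> B s \<Longrightarrow> t \<in> N \<Longrightarrow> v \<in> B t \<Longrightarrow>
      (s, t) \<in> (arcs \<inter> {t \<in> N. v \<in> B t} \<times> {t \<in> N. v \<in> B t})\<^sup>*"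
    and adhesion: "(s, t) \<in> arcs \<Longrightarrow> card (B s \<inter> B t) \<le> 2"
    and H: "t \<in> N \<Longrightarrow> wf_trigraph (H t)" "t \<in> N \<Longrightarrow> tverts (H t) = B t" "t \<in> N \<Longrightarrow> tww (H t) \<le> d"
    and H_red: "(s, t) \<in> arcs \<Longrightarrow> u \<in> B s \<inter> B t \<Longrightarrow> v \<in> B s \<inter> B t \<Longrightarrow> u \<noteq> v \<Longrightarrow> (u, v) \<in> red (H t)"
    and H_black: "t \<in> N \<Longrightarrow> u \<in> B t \<Longrightarrow> v \<in> B t \<Longrightarrow> u \<noteq> v \<Longrightarrow> (u, v) \<notin> red (H t) \<Longrightarrow>
      (u, v) \<in> E \<longleftrightarrow> (u, v) \<in> black (H t)"
    and D: "5 * d + 12 \<le> D" "18 \<le> D"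
begin

definition up :: "'t rel" where "up = {(t, par t) | t. t \<in> N \<and> t \<noteq> r}"

definition upv :: "'a \<Rightarrow> 't rel" where
  "upv v = {(t, par t) | t. t \<in> N \<and> t \<noteq> r \<and> v \<in> B t \<and> v \<in> B (par t)}"

definition top_bag :: "'a \<Rightarrow> 't \<Rightarrow> bool" where
  "top_bag v t \<longleftrightarrow> t \<in> N \<and> v \<in> B t \<and> (t = r \<or> v \<notin> B (par t))"

text \<open>The choice is formal: by \<open>top_bag_up\<close> all bags of \<open>v\<close> climb to
  each of its top bags, so there is only one.\<close>

definition home :: "'a \<Rightarrow> 't" where "home v = (SOME t. top_bag v t)"

text \<open>Each vertex is counted at its topmost bag, so these are the vertices of the subtree at
  \<open>t\<close> without those shared with the parent.\<close>

definition below :: "'t \<Rightarrow> 'a set" where "below t = {v \<in> V. (home v, t) \<in> up\<^sup>*}"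

text \<open>The empty set at the root makes all traces there equal, so the last partition has a
  single part.\<close>

definition adh :: "'t \<Rightarrow> 'a set" where "adh t = (if t = r then {} else B t \<inter> B (par t))"

lemma upv_subset: "upv v \<subseteq> up" by (auto simp: upv_def up_def)

lemma single_valued_up: "single_valued up" by (auto simp: up_def single_valued_def)

lemma up_dep: "(a, b) \<in> up\<^sup>* \<Longrightarrow> a = b \<or> dep b < dep a"
proof (induction rule: rtrancl_induct)
  case (step y z)
  then have "dep z < dep y" using par(2) by (auto simp: up_def)
  then show ?case using step.IH by auto
qed simp

lemma up_antisym: "(a, b) \<in> up\<^sup>* \<Longrightarrow> (b, a) \<in> up\<^sup>* \<Longrightarrow> a = b"
  using up_dep[of a b] up_dep[of b a] by auto

lemma up_comparable: "(t, a) \<in> up\<^sup>* \<Longrightarrow> (t, b) \<in> up\<^sup>* \<Longrightarrow> (a, b) \<in> up\<^sup>* \<or> (b, a) \<in> up\<^sup>*"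
  using single_valued_confluent[OF single_valued_up] .

lemma up_stepD: "(a, b) \<in> up\<^sup>* \<Longrightarrow> a \<noteq> b \<Longrightarrow> a \<in> N \<and> a \<noteq> r \<and> (par a, b) \<in> up\<^sup>*"
  by (erule converse_rtranclE) (auto simp: up_def)

lemma upv_stepD: "(a, b) \<in> (upv v)\<^sup>* \<Longrightarrow> a \<noteq> b \<Longrightarrow> a \<noteq> r \<and> v \<in> B (par a) \<and> (par a, b) \<in> (upv v)\<^sup>*"
  by (erule converse_rtranclE) (auto simp: upv_def)

text \<open>Walk through the bags of \<open>v\<close> from \<open>s\<close> to \<open>t\<close>,
  keeping an ascending route back to \<open>s\<close>. A step down prepends an arc to the route; a
  step up removes its first arc, which exists because no bag of \<open>v\<close> lies directly above
  \<open>s\<close>.\<close>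

lemma top_bag_up:
  assumes "v \<in> V" "top_bag v s" "t \<in> N" "v \<in> B t"
  shows "(t, s) \<in> (upv v)\<^sup>*"
proof -
  have s: "s \<in> N" "v \<in> B s" using assms(2) by (auto simp: top_bag_def)
  from conn[OF assms(1) s assms(3,4)] show ?thesis
  proof (induction rule: rtrancl_induct)
    case (step y z)
    then have yz: "(y, z) \<in> arcs" "y \<in> N" "z \<in> N" "v \<in> B y" "v \<in> B z" by auto
    from arcs[OF yz(1)] consider "y \<noteq> r" "z = par y" | "z \<noteq> r" "y = par z" by blast
    then show ?case
    proof cases
      case 1
      then have "y \<noteq> s" using assms(2) yz(5) by (auto simp: top_bag_def)
      then show ?thesis using upv_stepD[OF step.IH] 1 by simp
    next
      case 2
      then have "(z, y) \<in> upv v" using yz unfolding upv_def by blast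
      then show ?thesis using step.IH by (rule converse_rtrancl_into_rtrancl)
    qed
  qed simp
qed

lemma top_bag_home: "v \<in> V \<Longrightarrow> top_bag v (home v)"
proof -
  assume v: "v \<in> V"
  obtain t where t: "t \<in> N" "v \<in> B t" using bags(2)[OF v] by blast
  obtain s where s: "s \<in> N \<and> v \<in> B s" "\<And>s'. s' \<in> N \<and> v \<in> B s' \<Longrightarrow> dep s \<le> dep s'"
    using ex_has_least_nat[of "\<lambda>t. t \<in> N \<and> v \<in> B t" t dep] t by blast
  have "v \<notin> B (par s)" if "s \<noteq> r" using s(2)[of "par s"] s(1) par(1,2)[of s] that by linarith
  then have "top_bag v s" using s(1) unfolding top_bag_def by blast
  then show ?thesis unfolding home_def by (rule someI)
qed

lemma home_up: "t \<in> N \<Longrightarrow> v \<in> B t \<Longrightarrow> (t, home v) \<in> (upv v)\<^sup>*"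
  using top_bag_up top_bag_home bags(1) by blast

lemma home_up': "t \<in> N \<Longrightarrow> v \<in> B t \<Longrightarrow> (t, home v) \<in> up\<^sup>*"
  using home_up rtrancl_mono[OF upv_subset] by blast

lemma homeD: "v \<in> V \<Longrightarrow> home v \<in> N \<and> v \<in> B (home v)"
  using top_bag_home by (auto simp: top_bag_def)

lemma home_eq_iff:
  assumes "t \<in> N" "v \<in> V"
  shows "home v = t \<longleftrightarrow> v \<in> B t - adh t"
proof
  show "v \<in> B t - adh t" if "home v = t"
    using top_bag_home[OF assms(2)] that by (auto simp: top_bag_def adh_def)
  assume v: "v \<in> B t - adh t"
  show "home v = t"
  proof (rule ccontr)
    assume "home v \<noteq> t"
    moreover have "v \<in> B t" using v by simp
    ultimately have "t \<noteq> r \<and> v \<in> B (par t)" using upv_stepD[OF home_up[OF assms(1)]] by metis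
    then show False using v by (simp add: adh_def)
  qed
qed

lemma bag_between:
  assumes "(t, home v) \<in> (upv v)\<^sup>*" "t \<in> N" "v \<in> B t" "(t, a) \<in> up\<^sup>*" "(a, home v) \<in> up\<^sup>*"
  shows "v \<in> B a"
  using assms
proof (induction rule: converse_rtrancl_induct)
  case base
  have "a = home v" using up_antisym[OF base.prems(4,3)] .
  then show ?case using base.prems(2) by simp
next
  case (step y z)
  have z: "z = par y" "z \<in> N" "v \<in> B z" using step.hyps(1) par(1) by (auto simp: upv_def)
  show ?case
  proof (cases "y = a")
    case True
    then show ?thesis using step.prems by simp
  next
    case False
    then have "(z, a) \<in> up\<^sup>*" using up_stepD[OF step.prems(3)] z(1) by simp
    then show ?thesis using step.IH z step.prems by blast
  qed
qed

text \<open>A bag containing the edge lies in the subtree at \<open>s\<close>. Ancestors of that bag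
  are comparable, so \<open>home v\<close> is in the subtree or strictly above \<open>s\<close>; in
  the second case the bags of \<open>v\<close> pass through both \<open>s\<close> and its
  parent.\<close>

lemma below_edges:
  assumes s: "s \<in> N" and w: "w \<in> below s" and e: "(w, v) \<in> E"
  shows "v \<in> below s \<union> adh s"
proof -
  obtain t where t: "t \<in> N" "w \<in> B t" "v \<in> B t" using E[OF e] by blast
  have vV: "v \<in> V" "w \<in> V" using t bags(1) by blast+
  have hw: "(home w, s) \<in> up\<^sup>*" using w by (simp add: below_def)
  show ?thesis
  proof (cases "(home v, s) \<in> up\<^sup>*")
    case True
    then show ?thesis using vV by (simp add: below_def)
  next
    case False
    have ts: "(t, s) \<in> up\<^sup>*" using home_up'[OF t(1,2)] hw by (rule rtrancl_trans)
    then have sv: "(s, home v) \<in> up\<^sup>*" using up_comparable[OF ts home_up'[OF t(1,3)]] False by blast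
    have vs: "v \<in> B s" using bag_between[OF home_up[OF t(1,3)] t(1,3) ts sv] .
    have "s \<noteq> home v" using False by auto
    then have "s \<noteq> r" "v \<in> B (par s)" using upv_stepD[OF home_up[OF s vs]] by auto
    then show ?thesis using vs by (simp add: adh_def)
  qed
qed

lemma adh_subset: "t \<in> N \<Longrightarrow> adh t \<subseteq> B t"
  by (auto simp: adh_def)

lemma card_adh: "t \<in> N \<Longrightarrow> card (adh t) \<le> 2"
  using adhesion par(3) by (simp add: adh_def)

section \<open>Induction from the leaves to the root\<close>

definition children :: "'t \<Rightarrow> 't set" where "children t = {s \<in> N. s \<noteq> r \<and> par s = t}"

lemma below_eq:
  assumes "t \<in> N"
  shows "below t = (B t - adh t) \<union> (\<Union>s\<in>children t. below s)"
proof (intro set_eqI iffI)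
  fix v assume "v \<in> below t"
  then have v: "v \<in> V" "(home v, t) \<in> up\<^sup>*" by (auto simp: below_def)
  from v(2) show "v \<in> (B t - adh t) \<union> (\<Union>s\<in>children t. below s)"
  proof (cases rule: rtranclE)
    case base
    then show ?thesis using home_eq_iff[OF assms v(1)] by blast
  next
    case (step s)
    then have "s \<in> children t" by (auto simp: up_def children_def)
    then show ?thesis using step(1) v(1) by (auto simp: below_def)
  qed
next
  fix v assume "v \<in> (B t - adh t) \<union> (\<Union>s\<in>children t. below s)"
  then show "v \<in> below t"
  proof
    assume v: "v \<in> B t - adh t"
    then have "v \<in> V" using bags(1)[OF assms] by blast
    then show ?thesis using home_eq_iff[OF assms] v by (auto simp: below_def)
  next
    assume "v \<in> (\<Union>s\<in>children t. below s)"
    then obtain s where s: "s \<in> children t" "v \<in> below s" by blast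
    then have "(s, t) \<in> up" by (auto simp: up_def children_def)
    then show ?thesis using s(2) by (auto simp: below_def intro: rtrancl_into_rtrancl)
  qed
qed

lemma below_merges:
  "t \<in> N \<Longrightarrow> ((\<lambda>v. {v}) ` below t, fibres (\<lambda>w. E `` {w} \<inter> adh t) (below t)) \<in> (merge_step E D)\<^sup>*"
\<comment> \<open>Children are deeper than \<open>t\<close>, so the complement of the depth makes
  their chains available.\<close>
proof (induction "Max (dep ` N) - dep t" arbitrary: t rule: less_induct)
  case less
  note t = less.prems
  have ch: "s \<in> N" "s \<noteq> r" "par s = t" "dep t < dep s" "(s, t) \<in> arcs" if "s \<in> children t" for s
    using that par[of s] by (auto simp: children_def)
  have notin: "(t, s) \<notin> up\<^sup>*" if "s \<in> children t" for s
    using up_dep[of t s] ch(4)[OF that] by auto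
  interpret bag E "H t" "adh t" "children t" below adh d D
  proof
    show "sym E" "5 * d + 12 \<le> D" "18 \<le> D" by (fact sym_E D)+
    show "wf_trigraph (H t)" "tww (H t) \<le> d" using H t by auto
    show "adh t \<subseteq> tverts (H t)" "card (adh t) \<le> 2" using adh_subset card_adh H(2) t by auto
    show "finite (children t)" using finite_N by (simp add: children_def)
    show "finite (below s)" for s using finite_V by (simp add: below_def)
    show "adh s \<subseteq> tverts (H t)" "card (adh s) \<le> 2" if "s \<in> children t" for s
      using ch[OF that] card_adh[of s] H(2)[OF t] by (auto simp: adh_def)
    show "below s \<inter> tverts (H t) = {}" if "s \<in> children t" for s
    proof -
      have False if v: "v \<in> below s" "v \<in> B t" for v
      proof -
        have "(t, s) \<in> up\<^sup>*" using rtrancl_trans[OF home_up'[OF t v(2)]] v(1) by (simp add: below_def)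
        then show False using notin \<open>s \<in> children t\<close> by blast
      qed
      then show ?thesis using H(2)[OF t] by blast
    qed
    have *: False if "s \<in> children t" "s' \<in> children t" "s \<noteq> s'" "(s, s') \<in> up\<^sup>*" for s s'
    proof -
      have "(t, s') \<in> up\<^sup>*" using up_stepD[OF that(4,3)] ch(3)[OF that(1)] by simp
      then show False using notin that(2) by blast
    qed
    show "below s \<inter> below s' = {}" if "s \<in> children t" "s' \<in> children t" "s \<noteq> s'" for s s'
    proof -
      have False if v: "v \<in> below s" "v \<in> below s'" for v
        using up_comparable[of "home v" s s'] * \<open>s \<in> children t\<close> \<open>s' \<in> children t\<close> \<open>s \<noteq> s'\<close> v
        by (auto simp: below_def)
      then show ?thesis by blast
    qed
    show "v \<in> below s \<union> adh s" if "s \<in> children t" "w \<in> below s" "(w, v) \<in> E" for s w v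
      using below_edges[OF ch(1)] that by blast
    show "(u, v) \<in> red (H t)" if "s \<in> children t" "u \<in> adh s" "v \<in> adh s" "u \<noteq> v" for s u v
      using H_red[OF ch(5)[OF that(1)]] that ch(2,3)[OF that(1)] by (simp add: adh_def)
    show "(u, v) \<in> E \<longleftrightarrow> (u, v) \<in> black (H t)"
      if "u \<in> tverts (H t)" "v \<in> tverts (H t)" "u \<noteq> v" "(u, v) \<notin> red (H t)" for u v
      using H_black[OF t] that H(2)[OF t] by simp
    show "((\<lambda>v. {v}) ` below s, fibres (\<lambda>w. E `` {w} \<inter> adh s) (below s)) \<in> (merge_step E D)\<^sup>*"
      if "s \<in> children t" for s
    proof (rule less.hyps)
      have "dep s \<le> Max (dep ` N)" using finite_N ch(1)[OF that] by simp
      then show "Max (dep ` N) - dep s < Max (dep ` N) - dep t" using ch(4)[OF that] by linarith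
      show "s \<in> N" using ch(1)[OF that] .
    qed
  qed
  have "I = below t" using below_eq[OF t] H(2)[OF t] by (simp add: I_def K_def)
  moreover have "cl = (\<lambda>w. E `` {w} \<inter> adh t)" by (rule ext) (simp add: cl_def)
  ultimately show ?case using bag_merges by simp
qed

lemma root_merges: "((\<lambda>v. {v}) ` V, {V}) \<in> (merge_step E D)\<^sup>*"
proof -
  have up_r: "(t, r) \<in> up\<^sup>*" if "t \<in> N" for t
    using that
  proof (induction "dep t" arbitrary: t rule: less_induct)
    case less
    show ?case
    proof (cases "t = r")
      case False
      then have "(t, par t) \<in> up" using less.prems unfolding up_def by blast
      moreover have "(par t, r) \<in> up\<^sup>*" using less.hyps par(1,2) less.prems False by blast
      ultimately show ?thesis by (rule converse_rtrancl_into_rtrancl)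
    qed simp
  qed
  have "below r = V" using up_r homeD by (auto simp: below_def)
  moreover have "fibres (\<lambda>w. E `` {w} \<inter> adh r) V = {V}"
    using fibres_const[OF V] by (simp add: adh_def)
  ultimately show ?thesis using below_merges[OF r] by simp
qed

end

section \<open>Rooting an undirected tree\<close>

lemma connected_rtrancl:
  assumes "connected G" "u \<in> verts G" "v \<in> verts G"
  shows "(u, v) \<in> (\<Union>e\<in>arcs G. {(tail G e, head G e), (head G e, tail G e)})\<^sup>*"
proof -
  have "u \<rightarrow>\<^sup>*\<^bsub>with_proj (mk_symmetric G)\<^esub> v"
    using assms unfolding connected_def strongly_connected_def by (simp add: mk_symmetric_def)
  then have "(u, v) \<in> (arcs_ends (with_proj (mk_symmetric G)))\<^sup>*"
    unfolding reachable_def by (rule rtrancl_on_rtranclI)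
  then show ?thesis by (simp add: mk_symmetric_def)
qed

lemma connected_induced_rtrancl:
  assumes "connected (with_proj T \<restriction> U)" "sym (parcs T)" "u \<in> U" "v \<in> U"
  shows "(u, v) \<in> (parcs T \<inter> U \<times> U)\<^sup>*"
proof -
  have "(u, v) \<in> (\<Union>e\<in>arcs (with_proj T \<restriction> U). {(fst e, snd e), (snd e, fst e)})\<^sup>*"
    using connected_rtrancl[OF assms(1)] assms(3,4) by simp
  moreover have "(\<Union>e\<in>arcs (with_proj T \<restriction> U). {(fst e, snd e), (snd e, fst e)}) \<subseteq> parcs T \<inter> U \<times> U"
    using assms(2) by (auto dest: symD)
  ultimately show ?thesis using rtrancl_mono by blast
qed

lemma pair_graph_sym: "pair_graph T \<Longrightarrow> sym (parcs T)"
proof -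
  assume "pair_graph T"
  then interpret pair_graph T .
  show ?thesis by (rule symI) (rule arcs_symmetric)
qed

text \<open>In \<open>T'\<close> the vertex \<open>t\<close> is deleted, so a simple path from
  \<open>b\<close> to \<open>b'\<close> avoids it and closes up through it. As
  \<open>b \<noteq> b'\<close>, the path has an arc; this gives length at least 3 and excludes a
  mere back and forth.\<close>

lemma cycle_through:
  assumes T: "pair_graph T" and tb: "(t, b) \<in> parcs T" "(b', t) \<in> parcs T" "b \<noteq> b'"
    and path: "(b, b') \<in> (parcs T \<inter> U \<times> U)\<^sup>*" "t \<notin> U"
  shows "\<exists>p. pre_digraph.cycle (with_proj T) p \<and> 3 \<le> length p"
proof -
  interpret T: pair_graph T by (rule T)
  define T' where "T' = \<lparr> pverts = pverts T - {t}, parcs = parcs T \<inter> (pverts T - {t}) \<times> (pverts T - {t}) \<rparr>"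
  interpret T': pair_wf_digraph T' by unfold_locales (auto simp: T'_def)
  have bt: "b \<noteq> t" "b' \<noteq> t" using tb T.no_loops' by blast+
  have mem: "b \<in> pverts T'" "b' \<in> pverts T'" using tb bt T.in_arcsD1 T.in_arcsD2 by (auto simp: T'_def)
  have sub: "parcs T \<inter> U \<times> U \<subseteq> parcs T'" using path(2) T.in_arcsD1 T.in_arcsD2 by (auto simp: T'_def)
  have "(b, b') \<in> (parcs T')\<^sup>*" using path(1) rtrancl_mono[OF sub] by blast
  then have "(b, b') \<in> rtrancl_on (pverts T') (parcs T')"
    by (rule rtrancl_consistent_rtrancl_on) (use mem T'.in_arcsD2 in auto)
  then have "b \<rightarrow>\<^sup>*\<^bsub>with_proj T'\<^esub> b'" unfolding reachable_def by simp
  then obtain p where "T'.apath b p b'" unfolding T'.reachable_apath by blast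
  then have p: "T'.awalk b p b'" "distinct (pawalk_verts b p)" unfolding T'.apath_def by auto
  have pv: "set (pawalk_verts b p) \<subseteq> pverts T'" "set p \<subseteq> parcs T'" "pcas b p b'"
    using p(1) by (auto elim: T'.awalkE)
  have ne: "p \<noteq> []" using pv(3) tb(3) by auto
  have verts: "pawalk_verts a (q @ [(c, e)]) = pawalk_verts a q @ [e]" if "pcas a q c" for a q c e
    using that by (induction q arbitrary: a) auto
  have cas: "pcas a (q @ [(c, e)]) e" if "pcas a q c" for a q c e
    using that by (induction q arbitrary: a) auto
  let ?c = "(t, b) # p @ [(b', t)]"
  have "T.awalk t ?c t"
    unfolding T.awalk_def using tb pv cas[OF pv(3)] T.in_arcsD1[OF tb(1)] by (auto simp: T'_def)
  moreover have "distinct (tl (pawalk_verts t ?c))"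
    using p(2) pv(1) verts[OF pv(3)] by (auto simp: T'_def)
  ultimately have "T.cycle ?c" unfolding T.cycle_def by blast
  moreover have "3 \<le> length ?c" using ne by (cases p) auto
  ultimately show ?thesis by blast
qed

text \<open>Any vertex can be the root, with the distance from it as depth. Two neighbours of
  \<open>t\<close>, neither deeper than \<open>t\<close>, are joined through the root without
  meeting \<open>t\<close>, which would give a cycle.\<close>

lemma undirected_tree_rooted:
  fixes T :: "'t pair_pre_digraph"
  assumes "undirected_tree T"
  shows "\<exists>r par. \<exists>dep :: 't \<Rightarrow> nat. r \<in> pverts T \<and>
    (\<forall>t\<in>pverts T. t \<noteq> r \<longrightarrow> par t \<in> pverts T \<and> dep (par t) < dep t \<and> (t, par t) \<in> parcs T) \<and>
    (\<forall>a b. (a, b) \<in> parcs T \<longrightarrow> a \<noteq> r \<and> b = par a \<or> b \<noteq> r \<and> a = par b)"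
proof -
  have T: "pair_graph T" "connected (with_proj T)"
    "\<not> (\<exists>p. pre_digraph.cycle (with_proj T) p \<and> 3 \<le> length p)"
    using assms by (auto simp: undirected_tree_def)
  interpret pair_graph T by (rule T(1))
  have sym: "sym (parcs T)" using T(1) by (rule pair_graph_sym)
  have "pverts T \<noteq> {}"
    using T(2) unfolding connected_def strongly_connected_def by (simp add: mk_symmetric_def)
  then obtain r where r: "r \<in> pverts T" by blast
  have reach: "(r, t) \<in> (parcs T)\<^sup>*" if "t \<in> pverts T" for t
  proof -
    have "(\<Union>e\<in>parcs T. {(fst e, snd e), (snd e, fst e)}) \<subseteq> parcs T" using sym by (auto dest: symD)
    from rtrancl_mono[OF this] show ?thesis using connected_rtrancl[OF T(2), of r t] r that by auto
  qed
  define dep where "dep t = (LEAST n. (r, t) \<in> parcs T ^^ n)" for t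
  have dep: "(r, t) \<in> parcs T ^^ dep t" if "t \<in> pverts T" for t
    unfolding dep_def using rtrancl_imp_relpow[OF reach[OF that]] by (rule LeastI_ex)
  have dep_le: "dep t \<le> n" if "(r, t) \<in> parcs T ^^ n" for t n
    unfolding dep_def using that by (rule Least_le)
  have pred: "\<exists>s\<in>pverts T. (t, s) \<in> parcs T \<and> dep s < dep t" if t: "t \<in> pverts T" "t \<noteq> r" for t
  proof (cases "dep t")
    case 0
    then show ?thesis using dep[OF t(1)] t(2) by simp
  next
    case (Suc n)
    then obtain s where s: "(r, s) \<in> parcs T ^^ n" "(s, t) \<in> parcs T" using dep[OF t(1)] by auto
    then have "dep s < dep t" "s \<in> pverts T" "(t, s) \<in> parcs T"
      using dep_le[OF s(1)] Suc in_arcsD1 symD[OF sym] by auto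
    then show ?thesis by blast
  qed
  \<comment> \<open>Past its start the route is strictly closer to the root than \<open>s\<close>,
    so it misses every \<open>t \<noteq> s\<close> with \<open>dep s \<le> dep t\<close>.\<close>
  have to_root: "(s, r) \<in> (parcs T \<inter> {u. u = s \<or> dep u < dep s} \<times> {u. u = s \<or> dep u < dep s})\<^sup>*"
    if "s \<in> pverts T" for s
    using that
  proof (induction "dep s" arbitrary: s rule: less_induct)
    case less
    show ?case
    proof (cases "s = r")
      case False
      then obtain s' where s': "s' \<in> pverts T" "(s, s') \<in> parcs T" "dep s' < dep s"
        using pred less.prems by blast
      let ?U = "\<lambda>s. {u. u = s \<or> dep u < dep s}"
      have "parcs T \<inter> ?U s' \<times> ?U s' \<subseteq> parcs T \<inter> ?U s \<times> ?U s" using s'(3) by auto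
      then have "(s', r) \<in> (parcs T \<inter> ?U s \<times> ?U s)\<^sup>*"
        using less.hyps[OF s'(3,1)] rtrancl_mono by blast
      moreover have "(s, s') \<in> parcs T \<inter> ?U s \<times> ?U s" using s' by simp
      ultimately show ?thesis by (rule converse_rtrancl_into_rtrancl[rotated])
    qed simp
  qed
  \<comment> \<open>The inequalities are not strict in order to exclude arcs within a level too:
    compared with the parent, such a neighbour would have to equal it.\<close>
  have unique: "b = b'"
    if "(t, b) \<in> parcs T" "(t, b') \<in> parcs T" "dep b \<le> dep t" "dep b' \<le> dep t" for t b b'
  proof (rule ccontr)
    assume ne: "b \<noteq> b'"
    let ?U = "{u. u \<noteq> t}"
    have bt: "b \<noteq> t" "b' \<noteq> t" using that no_loops' by blast+
    have tr: "(s, r) \<in> (parcs T \<inter> ?U \<times> ?U)\<^sup>*" if s: "(t, s) \<in> parcs T" "dep s \<le> dep t" "s \<noteq> t" for s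
    proof -
      have "parcs T \<inter> {u. u = s \<or> dep u < dep s} \<times> {u. u = s \<or> dep u < dep s} \<subseteq> parcs T \<inter> ?U \<times> ?U"
        using s(2,3) by auto
      then show ?thesis using to_root[OF in_arcsD2[OF s(1)]] rtrancl_mono by blast
    qed
    have "sym (parcs T \<inter> ?U \<times> ?U)" using sym by (auto simp: sym_def)
    then have "(r, b') \<in> (parcs T \<inter> ?U \<times> ?U)\<^sup>*"
      using tr[OF that(2,4) bt(2)] sym_rtrancl symD by metis
    then have "(b, b') \<in> (parcs T \<inter> ?U \<times> ?U)\<^sup>*"
      using tr[OF that(1,3) bt(1)] by (rule rtrancl_trans[rotated])
    then show False
      using cycle_through[OF T(1) that(1) symD[OF sym that(2)] ne] T(3) by blast
  qed
  define par where "par t = (SOME s. (t, s) \<in> parcs T \<and> dep s < dep t)" for t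
  have par: "(t, par t) \<in> parcs T \<and> dep (par t) < dep t" if "t \<in> pverts T" "t \<noteq> r" for t
    unfolding par_def by (rule someI_ex) (use pred[OF that] in blast)
  have dep_r: "dep r = 0" using dep_le[of r 0] by simp
  have pos: "0 < dep t" if "t \<in> pverts T" "t \<noteq> r" for t using par[OF that] by simp
  show ?thesis
  proof (intro exI conjI ballI allI impI)
    show "r \<in> pverts T" by (rule r)
    show "par t \<in> pverts T" "dep (par t) < dep t" "(t, par t) \<in> parcs T" if "t \<in> pverts T" "t \<noteq> r" for t
      using par[OF that] in_arcsD2 by blast+
    have half: "a \<noteq> r \<and> b = par a" if ab: "(a, b) \<in> parcs T" "dep b \<le> dep a" for a b
    proof -
      have v: "a \<in> pverts T" "b \<in> pverts T" using ab(1) in_arcsD1 in_arcsD2 by blast+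
      have "a \<noteq> r"
      proof
        assume "a = r"
        then have "b = r" using ab(2) dep_r pos[OF v(2)] by auto
        then show False using no_loops'[OF ab(1)] \<open>a = r\<close> by simp
      qed
      then show ?thesis using unique[OF ab(1) _ ab(2), of "par a"] par[OF v(1)] by simp
    qed
    show "a \<noteq> r \<and> b = par a \<or> b \<noteq> r \<and> a = par b" if ab: "(a, b) \<in> parcs T" for a b
      using half[OF ab] half[OF symD[OF sym ab]] by (cases "dep b \<le> dep a") auto
  qed
qed

section \<open>Assembling the bound\<close>

lemma triconnected_bag_nonempty:
  assumes "k_connected 3 (torso G T B t) \<or> cycle_graph (torso G T B t) \<or>
    complete_digraph 2 (with_proj (torso G T B t))"
  shows "B t \<noteq> {}"
proof -
  have "pverts (torso G T B t) = B t" by (simp add: torso_def)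
  moreover have "pverts (torso G T B t) \<noteq> {}"
    using assms by (auto simp: k_connected_def cycle_graph_def complete_digraph_def)
  ultimately show ?thesis by simp
qed

theorem theorem3:
  fixes G :: "'a pair_pre_digraph"
    and T :: "'t pair_pre_digraph"
    and B :: "'t \<Rightarrow> 'a set"
  assumes "pair_graph G"
    and "k_connected 2 G"
    and "triconnected_decomposition G T B"
  shows "tww (trigraph_of G) \<le> max (8 * (MAX t \<in> pverts T. tww (red_torso G T B t)) + 6) 18"
proof -
  interpret G: pair_graph G by (rule assms(1))
  have td: "undirected_tree T" "\<And>t. t \<in> pverts T \<Longrightarrow> B t \<subseteq> pverts G"
    "\<And>v. v \<in> pverts G \<Longrightarrow> \<exists>t\<in>pverts T. v \<in> B t"
    "\<And>v. v \<in> pverts G \<Longrightarrow> connected (with_proj T \<restriction> {t \<in> pverts T. v \<in> B t})"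
    "\<And>u v. (u, v) \<in> parcs G \<Longrightarrow> \<exists>t\<in>pverts T. u \<in> B t \<and> v \<in> B t"
    and adh: "\<And>s t. (s, t) \<in> parcs T \<Longrightarrow> card (B s \<inter> B t) \<le> 2"
    and ne: "\<And>t. t \<in> pverts T \<Longrightarrow> B t \<noteq> {}"
    using assms(3) triconnected_bag_nonempty[of G T B]
    unfolding triconnected_decomposition_def tree_decomposition_def adhesion_at_most_def by blast+
  have "pair_graph T" using td(1) by (simp add: undirected_tree_def)
  then interpret T: pair_graph T .
  have symG: "sym (parcs G)" and symT: "sym (parcs T)" by (rule pair_graph_sym, unfold_locales)+
  obtain r par and dep :: "'t \<Rightarrow> nat" where r: "r \<in> pverts T"
    and par: "\<And>t. t \<in> pverts T \<Longrightarrow> t \<noteq> r \<Longrightarrow> par t \<in> pverts T \<and> dep (par t) < dep t \<and> (t, par t) \<in> parcs T"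
    and arcs: "\<And>a b. (a, b) \<in> parcs T \<Longrightarrow> a \<noteq> r \<and> b = par a \<or> b \<noteq> r \<and> a = par b"
    using undirected_tree_rooted[OF td(1)] by blast
  define d where "d = (MAX t \<in> pverts T. tww (red_torso G T B t))"
  have V: "pverts G \<noteq> {}" using ne[OF r] td(2)[OF r] by blast
  have red: "red (red_torso G T B t) = virtual_edges T B t"
    and black: "black (red_torso G T B t) = parcs G \<inter> B t \<times> B t - virtual_edges T B t"
    and tv: "tverts (red_torso G T B t) = B t" for t
    by (auto simp: red_torso_def torso_def)
  have sym_virtual: "sym (virtual_edges T B t)" for t
    unfolding virtual_edges_def sym_def by auto
  interpret rooted_decomposition "pverts T" "parcs T" r par dep "pverts G" "parcs G" B
    "red_torso G T B" d "max (8 * d + 6) 18"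
  proof
    show "finite (pverts T)" "r \<in> pverts T" "finite (pverts G)" "pverts G \<noteq> {}" "sym (parcs G)"
      using T.pair_finite_verts r G.pair_finite_verts V symG by auto
    show "par t \<in> pverts T" "dep (par t) < dep t" "(t, par t) \<in> parcs T" "(par t, t) \<in> parcs T"
      if "t \<in> pverts T" "t \<noteq> r" for t
      using par[OF that] symD[OF symT] by blast+
    show "a \<in> pverts T \<and> b \<in> pverts T \<and> (a \<noteq> r \<and> b = par a \<or> b \<noteq> r \<and> a = par b)"
      if "(a, b) \<in> parcs T" for a b
      using arcs[OF that] T.in_arcsD1[OF that] T.in_arcsD2[OF that] by blast
    show "\<exists>t\<in>pverts T. u \<in> B t \<and> v \<in> B t" if "(u, v) \<in> parcs G" for u v
      using td(5)[OF that] .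
    show "B t \<subseteq> pverts G" if "t \<in> pverts T" for t using td(2)[OF that] .
    show "\<exists>t\<in>pverts T. v \<in> B t" if "v \<in> pverts G" for v using td(3)[OF that] .
    show "(s, t) \<in> (parcs T \<inter> {t \<in> pverts T. v \<in> B t} \<times> {t \<in> pverts T. v \<in> B t})\<^sup>*"
      if "v \<in> pverts G" "s \<in> pverts T" "v \<in> B s" "t \<in> pverts T" "v \<in> B t" for v s t
      using connected_induced_rtrancl[OF td(4)[OF that(1)] symT] that by simp
    show "card (B s \<inter> B t) \<le> 2" if "(s, t) \<in> parcs T" for s t using adh[OF that] .
    show "tverts (red_torso G T B t) = B t" for t by (rule tv)
    show "wf_trigraph (red_torso G T B t)" if t: "t \<in> pverts T" for t
    proof -
      have "finite (B t)" using td(2)[OF t] G.pair_finite_verts by (rule finite_subset)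
      moreover have "virtual_edges T B t \<subseteq> B t \<times> B t" "irrefl (virtual_edges T B t)"
        by (auto simp: virtual_edges_def irrefl_def)
      moreover have "irrefl (parcs G)" using G.no_loops' by (auto simp: irrefl_def)
      moreover have "sym (parcs G \<inter> B t \<times> B t - virtual_edges T B t)"
        using symG sym_virtual[of t] by (auto simp: sym_def)
      ultimately show ?thesis
        unfolding wf_trigraph_def red black tv using ne[OF t] sym_virtual[of t] by (auto simp: irrefl_def)
    qed
    show "tww (red_torso G T B t) \<le> d" if "t \<in> pverts T" for t
      unfolding d_def using that T.pair_finite_verts by (intro Max_ge) auto
    show "(u, v) \<in> red (red_torso G T B t)"
      if "(s, t) \<in> parcs T" "u \<in> B s \<inter> B t" "v \<in> B s \<inter> B t" "u \<noteq> v" for s t u v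
      unfolding red virtual_edges_def using that by blast
    show "(u, v) \<in> parcs G \<longleftrightarrow> (u, v) \<in> black (red_torso G T B t)"
      if "u \<in> B t" "v \<in> B t" "(u, v) \<notin> red (red_torso G T B t)" for t u v
      using that unfolding red black by blast
    \<comment> \<open>For \<open>d \<le> 1\<close> the left side is at most 17; from
      \<open>d = 2\<close> on it is at most \<open>8d + 6\<close>.\<close>
    show "5 * d + 12 \<le> max (8 * d + 6) 18" unfolding le_max_iff_disj by (cases "d \<le> 1") auto
    show "18 \<le> max (8 * d + 6) 18" by simp
  qed
  have "wf_trigraph (trigraph_of G)"
    using V G.pair_finite_verts symG G.no_loops' G.in_arcsD1 G.in_arcsD2
    by (auto simp: wf_trigraph_def trigraph_of_def irrefl_def sym_def)
  then have "tww (trigraph_of G) \<le> max (8 * d + 6) 18"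
    using root_merges narrow_singletons by (intro tww_le_merges) (simp_all add: trigraph_of_def)
  then show ?thesis unfolding d_def .
qed

end
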